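(* There exist positive integers $k$ and $t$ such that there is no algorithm which, given a monoid morphism $\mu\colon\Delta^*\to\mathbb{Z}^{k\times k}_{\rm uptr}$, where $\Delta=\{x,y,z_1,z_2\}$ is an alphabet of four distinct letters, decides whether the restriction of $\mu$ to the language $K_t=z_1(x^*y)^{t-1}x^*z_2$ is injective.
   Context: $\mathbb{Z}^{k\times k}_{\rm uptr}$ denotes the monoid (under matrix multiplication) of upper-triangular $k\times k$ matrices with integer entries. $K_t$ is the set of words $z_1x^{a_1}yx^{a_2}y\cdots yx^{a_t}z_2$ with $a_1,\ldots,a_t\ge 0$ (with $t-1$ occurrences of $y$). A morphism $\mu$ is given by the integer matrices $\mu(x),\mu(y),\mu(z_1),\mu(z_2)$. *)

theory Defs
  imports "Jordan_Normal_Form.Matrix" "HOL-Library.Nat_Bijection"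
begin

datatype letter = X | Y | Z1 | Z2

definition letters :: "letter list" where
  "letters = [X, Y, Z1, Z2]"

text \<open>A monoid morphism mu from Delta* to k x k integer matrices is determined by
  the images of the four letters; its value on a word is the ordered product.\<close>
definition morph_word :: "nat \<Rightarrow> (letter \<Rightarrow> int mat) \<Rightarrow> letter list \<Rightarrow> int mat" where
  "morph_word k \<mu> w = foldr (\<lambda>c M. \<mu> c * M) w (1\<^sub>m k)"

definition uptr_morphisms :: "nat \<Rightarrow> (letter \<Rightarrow> int mat) set" where
  "uptr_morphisms k = {\<mu>. \<forall>c. \<mu> c \<in> carrier_mat k k \<and> upper_triangular (\<mu> c)}"

fun xy_block :: "nat list \<Rightarrow> letter list" where
  "xy_block [] = []"
| "xy_block [a] = replicate a X"
| "xy_block (a # b # as) = replicate a X @ Y # xy_block (b # as)"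

definition K :: "nat \<Rightarrow> letter list set" where
  "K t = {[Z1] @ xy_block as @ [Z2] | as. length as = t}"

datatype recf = Zf | Sf | Idf nat | Cn recf "recf list" | Pr recf recf | Mn recf

inductive rec_eval :: "recf \<Rightarrow> nat list \<Rightarrow> nat \<Rightarrow> bool" where
  zero: "rec_eval Zf xs 0"
| succ: "rec_eval Sf (x # xs) (Suc x)"
| proj: "i < length xs \<Longrightarrow> rec_eval (Idf i) xs (xs ! i)"
| comp: "length ys = length gs \<Longrightarrow> (\<forall>i < length gs. rec_eval (gs ! i) xs (ys ! i))
          \<Longrightarrow> rec_eval f ys z \<Longrightarrow> rec_eval (Cn f gs) xs z"
| prim0: "rec_eval f xs y \<Longrightarrow> rec_eval (Pr f g) (0 # xs) y"
| primS: "rec_eval (Pr f g) (n # xs) y \<Longrightarrow> rec_eval g (n # y # xs) z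
          \<Longrightarrow> rec_eval (Pr f g) (Suc n # xs) z"
| mini: "rec_eval f (n # xs) 0 \<Longrightarrow> (\<forall>m < n. \<exists>y. 0 < y \<and> rec_eval f (m # xs) y)
          \<Longrightarrow> rec_eval (Mn f) xs n"

definition decidable_on :: "'a set \<Rightarrow> ('a \<Rightarrow> nat) \<Rightarrow> ('a \<Rightarrow> bool) \<Rightarrow> bool" where
  "decidable_on I code P \<longleftrightarrow>
     (\<exists>f. \<forall>a \<in> I. rec_eval f [code a] (if P a then 1 else 0))"

definition encode_mat :: "nat \<Rightarrow> int mat \<Rightarrow> nat" where
  "encode_mat k A = list_encode (map (\<lambda>i. list_encode (map (\<lambda>j. int_encode (A $$ (i, j))) [0..<k])) [0..<k])"

definition encode_morph :: "nat \<Rightarrow> (letter \<Rightarrow> int mat) \<Rightarrow> nat" where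
  "encode_morph k \<mu> = list_encode (map (\<lambda>c. encode_mat k (\<mu> c)) letters)"

end

theory Submission
  imports Defs "HOL-Number_Theory.Cong"
begin

text \<open>If \<open>\<mu> x\<close> has diagonal entries \<open>1\<close> and \<open>2\<close>, the entries of
  \<open>\<mu> (z\<^sub>1 x\<^bsup>a\<^sub>1\<^esup> y \<dots> y x\<^bsup>a\<^sub>t\<^esup> z\<^sub>2)\<close> can be arbitrary sums of products of functions
  \<open>a\<^sub>i\<^bsup>m\<^esup> 2\<^bsup>a\<^sub>i\<^esup>\<close>. Given a system of equations \<open>D\<^sub>r(a\<^sub>1, \<dots>, a\<^sub>m) = 0\<close> of this kind, choose \<open>\<mu>\<close> such that
  these entries are \<open>a\<^sub>1, \<dots>, a\<^sub>m\<close> and all \<open>b D\<^sub>r\<close>, where \<open>b\<close> is one further exponent. A collision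
  can only change \<open>b\<close>, so \<open>\<mu>\<close> is injective on the language iff the system has no solution.

  Because powers of \<open>2\<close> come for free, it suffices that one undecidable set is exponential
  Diophantine, and the theorem of Davis, Putnam and Robinson provides this: derivations of
  \<open>rec_eval\<close> are coded as sequences of numbers, and the single bounded universal quantifier over the
  steps of a derivation is eliminated by computing modulo a binomial coefficient with many large
  pairwise coprime factors. The undecidable set consists of the codes \<open>e\<close> of functions that map \<open>e\<close>
  to \<open>1\<close>. A decision procedure for injectivity would decide its complement with value \<open>1\<close>, and
  running it on its own code is contradictory.\<close>

section \<open>Existential systems of exponential equations\<close>

text \<open>Two constraints shape the development. The dimension and the number of exponents must be
  the same for all instances, so a single system is fixed and only the number \<open>e\<close>
  varies; it enters the morphism as a literal matrix entry. Moreover, the modular arithmetic that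
  eliminates the bounded quantifier respects sums and products but not powers, because the residue
  of an exponent does not determine the residue of the power. Everything below that quantifier must
  therefore be free of exponentials, while its elimination introduces factorials and binomial
  coefficients, which are defined here by means of powers, so the elimination cannot be repeated in
  this form. One use suffices because a step of a derivation is justified by a purely existential
  condition on earlier steps. The flag of \<open>dio\<close> keeps track of this.\<close>

datatype atom = Const nat nat | Add nat nat nat | Mul nat nat nat | Pow nat nat

fun sat :: "(nat \<Rightarrow> nat) \<Rightarrow> atom \<Rightarrow> bool" where
  "sat v (Const i c) \<longleftrightarrow> v i = c"
| "sat v (Add i j k) \<longleftrightarrow> v i = v j + v k"
| "sat v (Mul i j k) \<longleftrightarrow> v i = v j * v k"
| "sat v (Pow i j) \<longleftrightarrow> v i = 2 ^ v j"

fun rename :: "(nat \<Rightarrow> nat) \<Rightarrow> atom \<Rightarrow> atom" where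
  "rename r (Const i c) = Const (r i) c"
| "rename r (Add i j k) = Add (r i) (r j) (r k)"
| "rename r (Mul i j k) = Mul (r i) (r j) (r k)"
| "rename r (Pow i j) = Pow (r i) (r j)"

fun is_Pow :: "atom \<Rightarrow> bool" where
  "is_Pow (Pow i j) \<longleftrightarrow> True"
| "is_Pow _ \<longleftrightarrow> False"

lemma sat_rename: "sat v (rename r a) \<longleftrightarrow> sat (v \<circ> r) a"
  by (cases a) auto

lemma is_Pow_rename [simp]: "is_Pow (rename r a) = is_Pow a"
  by (cases a) auto

text \<open>The flag \<open>p\<close> tells whether exponentials are allowed: \<open>dio False\<close> is the class of Diophantine
  relations and \<open>dio True\<close> that of exponential Diophantine relations. Variables \<open>i < n\<close> are the
  free ones, all others are existentially quantified.\<close>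

definition dio :: "bool \<Rightarrow> ((nat \<Rightarrow> nat) \<Rightarrow> bool) \<Rightarrow> bool" where
  "dio p R \<longleftrightarrow> (\<exists>As n. (\<forall>a\<in>set As. is_Pow a \<longrightarrow> p) \<and>
     (\<forall>v. R v \<longleftrightarrow> (\<exists>w. (\<forall>i<n. w i = v i) \<and> (\<forall>a\<in>set As. sat w a))))"

text \<open>The graph is written in de Bruijn style: coordinate 0 holds the value and the arguments
  are shifted by one, so that composition becomes quantification over coordinate 0.\<close>

definition diof :: "bool \<Rightarrow> ((nat \<Rightarrow> nat) \<Rightarrow> nat) \<Rightarrow> bool" where
  "diof p f \<longleftrightarrow> dio p (\<lambda>v. v 0 = f (\<lambda>i. v (Suc i)))"

lemma dioI:
  assumes "\<And>a. a \<in> set As \<Longrightarrow> is_Pow a \<Longrightarrow> p"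
    and "\<And>v. R v \<longleftrightarrow> (\<exists>w. (\<forall>i<n. w i = v i) \<and> (\<forall>a\<in>set As. sat w a))"
  shows "dio p R"
  using assms unfolding dio_def by blast

text \<open>Besides substituting coordinates, this raises the number of free coordinates to at least
  \<open>m\<close>; with the identity for \<open>r\<close> it lets two systems be aligned.\<close>

lemma dio_rename_at_least:
  assumes "dio p R"
  shows "\<exists>As n. n \<ge> m \<and> (\<forall>a\<in>set As. is_Pow a \<longrightarrow> p) \<and>
     (\<forall>v. R (\<lambda>i. v (r i)) \<longleftrightarrow> (\<exists>w. (\<forall>i<n. w i = v i) \<and> (\<forall>a\<in>set As. sat w a)))"
proof -
  obtain As n where As: "\<forall>a\<in>set As. is_Pow a \<longrightarrow> p"
    and R: "\<And>v. R v \<longleftrightarrow> (\<exists>w. (\<forall>i<n. w i = v i) \<and> (\<forall>a\<in>set As. sat w a))"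
    using assms unfolding dio_def by blast
  \<comment> \<open>\<open>N\<close> lies above every \<open>r i\<close> with \<open>i < n\<close>,
    so \<open>N + i\<close> is a fresh place for a quantified variable.\<close>
  define N where "N = m + (\<Sum>i<n. Suc (r i))"
  have N: "r i < N" if "i < n" for i
    using member_le_sum[of i "{..<n}" "\<lambda>i. Suc (r i)"] that unfolding N_def by force
  define s where "s = (\<lambda>i. if i < n then r i else N + i)"
  have "R (\<lambda>i. v (r i)) \<longleftrightarrow> (\<exists>u. (\<forall>i<N. u i = v i) \<and> (\<forall>a\<in>set (map (rename s) As). sat u a))" for v
  proof
    assume "R (\<lambda>i. v (r i))"
    then obtain w where w: "\<forall>i<n. w i = v (r i)" "\<forall>a\<in>set As. sat w a"
      unfolding R by blast
    define u where "u = (\<lambda>i. if i < N then v i else w (i - N))"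
    have "u \<circ> s = w"
      using w(1) N unfolding u_def s_def by (auto simp: fun_eq_iff)
    then show "\<exists>u. (\<forall>i<N. u i = v i) \<and> (\<forall>a\<in>set (map (rename s) As). sat u a)"
      using w(2) by (intro exI[of _ u]) (auto simp: sat_rename u_def)
  next
    assume "\<exists>u. (\<forall>i<N. u i = v i) \<and> (\<forall>a\<in>set (map (rename s) As). sat u a)"
    then obtain u where u: "\<forall>i<N. u i = v i" "\<forall>a\<in>set As. sat (u \<circ> s) a"
      by (auto simp: sat_rename)
    then show "R (\<lambda>i. v (r i))"
      unfolding R using N by (intro exI[of _ "u \<circ> s"]) (auto simp: s_def)
  qed
  moreover have "m \<le> N" by (simp add: N_def)
  ultimately show ?thesis
    using As by (intro exI[of _ "map (rename s) As"] exI[of _ N]) auto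
qed

lemma dio_rename: "dio p R \<Longrightarrow> dio p (\<lambda>v. R (\<lambda>i. v (r i)))"
  using dio_rename_at_least[of p R 0 r] unfolding dio_def by blast

lemma dio_support:
  assumes "dio p R"
  obtains n where "n \<ge> m" "\<And>v w. (\<And>i. i < n \<Longrightarrow> v i = w i) \<Longrightarrow> R v = R w"
proof -
  obtain As n where n: "n \<ge> m" and R: "\<And>v. R v \<longleftrightarrow> (\<exists>w. (\<forall>i<n. w i = v i) \<and> (\<forall>a\<in>set As. sat w a))"
    using dio_rename_at_least[OF assms, of m "\<lambda>i. i"] by auto
  show ?thesis
    by (rule that[OF n]) (simp add: R)
qed

lemma dio_conj:
  assumes "dio p R" "dio p S"
  shows "dio p (\<lambda>v. R v \<and> S v)"
proof -
  obtain As n where As: "\<forall>a\<in>set As. is_Pow a \<longrightarrow> p"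
    and R: "\<And>v. R v \<longleftrightarrow> (\<exists>w. (\<forall>i<n. w i = v i) \<and> (\<forall>a\<in>set As. sat w a))"
    using assms unfolding dio_def by blast
  obtain Bs m where mn: "m \<ge> n" and Bs: "\<forall>a\<in>set Bs. is_Pow a \<longrightarrow> p"
    and S: "\<And>v. S v \<longleftrightarrow> (\<exists>w. (\<forall>i<m. w i = v i) \<and> (\<forall>a\<in>set Bs. sat w a))"
    using dio_rename_at_least[OF assms(2), of n "\<lambda>i. i"] by auto
  \<comment> \<open>Parity above \<open>m\<close> keeps the quantified variables of the two systems
    apart.\<close>
  define s where "s = (\<lambda>i. if i < n then i else m + 2 * i)"
  define t where "t = (\<lambda>i. if i < m then i else m + 2 * i + 1)"
  have *: "(\<forall>a\<in>set (map (rename s) As @ map (rename t) Bs). sat u a) \<longleftrightarrow>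
      (\<forall>a\<in>set As. sat (u \<circ> s) a) \<and> (\<forall>a\<in>set Bs. sat (u \<circ> t) a)" for u
    by (simp add: sat_rename ball_Un)
  have "R v \<and> S v \<longleftrightarrow> (\<exists>u. (\<forall>i<m. u i = v i) \<and> (\<forall>a\<in>set (map (rename s) As @ map (rename t) Bs). sat u a))" for v
  proof
    assume "R v \<and> S v"
    then obtain w x where w: "\<forall>i<n. w i = v i" "\<forall>a\<in>set As. sat w a"
      and x: "\<forall>i<m. x i = v i" "\<forall>a\<in>set Bs. sat x a"
      unfolding R S by blast
    define u where "u = (\<lambda>i. if i < m then v i else if even (i - m) then w ((i - m) div 2) else x ((i - m) div 2))"
    have "u \<circ> s = w"
      using w(1) mn unfolding u_def s_def by (auto simp: fun_eq_iff)
    moreover have "u \<circ> t = x"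
      using x(1) unfolding u_def t_def by (auto simp: fun_eq_iff)
    ultimately show "\<exists>u. (\<forall>i<m. u i = v i) \<and> (\<forall>a\<in>set (map (rename s) As @ map (rename t) Bs). sat u a)"
      unfolding * using w(2) x(2) by (intro exI[of _ u]) (simp add: u_def)
  next
    assume "\<exists>u. (\<forall>i<m. u i = v i) \<and> (\<forall>a\<in>set (map (rename s) As @ map (rename t) Bs). sat u a)"
    then obtain u where u: "\<forall>i<m. u i = v i" "\<forall>a\<in>set As. sat (u \<circ> s) a" "\<forall>a\<in>set Bs. sat (u \<circ> t) a"
      unfolding * by blast
    have "R v"
      unfolding R using u mn by (intro exI[of _ "u \<circ> s"]) (auto simp: s_def)
    moreover have "S v"
      unfolding S using u by (intro exI[of _ "u \<circ> t"]) (auto simp: t_def)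
    ultimately show "R v \<and> S v" ..
  qed
  moreover have "\<forall>a\<in>set (map (rename s) As @ map (rename t) Bs). is_Pow a \<longrightarrow> p"
    using As Bs by (auto simp: ball_Un)
  ultimately show ?thesis
    unfolding dio_def by blast
qed

lemma dio_project:
  assumes "dio p S"
  shows "dio p (\<lambda>v. \<exists>w. (\<forall>i<n. w i = v i) \<and> S w)"
proof -
  obtain As m where As: "\<forall>a\<in>set As. is_Pow a \<longrightarrow> p"
    and S: "\<And>v. S v \<longleftrightarrow> (\<exists>w. (\<forall>i<m. w i = v i) \<and> (\<forall>a\<in>set As. sat w a))"
    using assms unfolding dio_def by blast
  have "(\<exists>w. (\<forall>i<n. w i = v i) \<and> S w) \<longleftrightarrow> (\<exists>u. (\<forall>i<min n m. u i = v i) \<and> (\<forall>a\<in>set As. sat u a))" for v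
  proof
    assume "\<exists>u. (\<forall>i<min n m. u i = v i) \<and> (\<forall>a\<in>set As. sat u a)"
    then obtain u where u: "\<forall>i<min n m. u i = v i" "\<forall>a\<in>set As. sat u a" by blast
    then have "S (\<lambda>i. if i < n then v i else u i)"
      unfolding S by (intro exI[of _ u]) simp
    then show "\<exists>w. (\<forall>i<n. w i = v i) \<and> S w"
      by (intro exI[of _ "\<lambda>i. if i < n then v i else u i"]) auto
  next
    assume "\<exists>w. (\<forall>i<n. w i = v i) \<and> S w"
    then obtain w u where "\<forall>i<n. w i = v i" "\<forall>i<m. u i = w i" "\<forall>a\<in>set As. sat u a"
      unfolding S by blast
    then show "\<exists>u. (\<forall>i<min n m. u i = v i) \<and> (\<forall>a\<in>set As. sat u a)"
      by (intro exI[of _ u]) simp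
  qed
  then show ?thesis
    using As unfolding dio_def by blast
qed

lemma dio_ex:
  assumes "dio p (\<lambda>v. R (\<lambda>i. v (Suc i)) (v 0))"
  shows "dio p (\<lambda>v. \<exists>x. R v x)"
proof -
  obtain n where n: "\<And>v w. (\<And>i. i < n \<Longrightarrow> v i = w i) \<Longrightarrow>
      R (\<lambda>i. v (Suc i)) (v 0) = R (\<lambda>i. w (Suc i)) (w 0)"
    using dio_support[OF assms, of 0] by auto
  \<comment> \<open>The quantified value is stored behind the free coordinates, at \<open>n\<close>,
    where the truth of \<open>R v x\<close> does not depend on \<open>v\<close>.\<close>
  define s where "s = case_nat n (\<lambda>j. j)"
  let ?S = "\<lambda>w. R (\<lambda>i. w (s (Suc i))) (w (s 0))"
  have S: "dio p ?S"
    using dio_rename[OF assms, of s] by simp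
  have "(\<exists>x. R v x) \<longleftrightarrow> (\<exists>w. (\<forall>i<n. w i = v i) \<and> ?S w)" for v
  proof
    assume "\<exists>x. R v x"
    then obtain x where x: "R v x" ..
    have "?S (v(n := x)) = R v x"
      using n[of "\<lambda>i. (v(n := x)) (s i)" "case_nat x v"] by (auto simp: s_def split: nat.splits)
    then show "\<exists>w. (\<forall>i<n. w i = v i) \<and> ?S w"
      using x by (intro exI[of _ "v(n := x)"]) auto
  next
    assume "\<exists>w. (\<forall>i<n. w i = v i) \<and> ?S w"
    then obtain w where w: "\<forall>i<n. w i = v i" "?S w" by blast
    have "?S w = R v (w n)"
      using n[of "\<lambda>i. w (s i)" "case_nat (w n) v"] w by (auto simp: s_def split: nat.splits)
    then show "\<exists>x. R v x" using w by auto
  qed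
  then show ?thesis
    using dio_project[OF S, of n] by simp
qed

lemma dio_let:
  assumes "dio p (\<lambda>v. R (\<lambda>i. v (Suc i)) (v 0))" "diof p f"
  shows "dio p (\<lambda>v. R v (f v))"
proof -
  have "dio p (\<lambda>v. \<exists>x. x = f v \<and> R v x)"
    using assms unfolding diof_def by (intro dio_ex dio_conj)
  then show ?thesis by simp
qed

lemma dio_atom: "(is_Pow a \<Longrightarrow> p) \<Longrightarrow> dio p (\<lambda>v. sat v a)"
proof (rule dioI[where As = "[a]" and n = "case a of Const i c \<Rightarrow> Suc i | Add i j k \<Rightarrow> Suc (i + j + k)
     | Mul i j k \<Rightarrow> Suc (i + j + k) | Pow i j \<Rightarrow> Suc (i + j)"], simp)
  fix v
  let ?n = "case a of Const i c \<Rightarrow> Suc i | Add i j k \<Rightarrow> Suc (i + j + k)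
     | Mul i j k \<Rightarrow> Suc (i + j + k) | Pow i j \<Rightarrow> Suc (i + j)"
  have "sat w a = sat v a" if "\<forall>i<?n. w i = v i" for w
    using that by (cases a) auto
  then show "sat v a \<longleftrightarrow> (\<exists>w. (\<forall>i<?n. w i = v i) \<and> (\<forall>a\<in>set [a]. sat w a))"
    by (metis empty_iff empty_set list.set_intros(1) set_ConsD)
qed

lemma diof_shift: "diof p f \<Longrightarrow> diof p (\<lambda>v. f (\<lambda>i. v (Suc i)))"
  unfolding diof_def
  using dio_rename[of p "\<lambda>v. v 0 = f (\<lambda>i. v (Suc i))" "\<lambda>i. case i of 0 \<Rightarrow> 0 | Suc j \<Rightarrow> Suc (Suc j)"]
  by simp

lemma dio_eq_var: "dio p (\<lambda>v. v i = v j)"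
proof -
  have "dio p (\<lambda>v. \<exists>z. z = 0 \<and> v i = v j + z)"
    using dio_atom[of "Const 0 0" p] dio_atom[of "Add (Suc i) (Suc j) 0" p]
    by (intro dio_ex dio_conj) simp_all
  then show ?thesis by simp
qed

lemma diof_var: "diof p (\<lambda>v. v i)"
  unfolding diof_def by (rule dio_eq_var)

lemma diof_const: "diof p (\<lambda>v. c)"
  unfolding diof_def using dio_atom[of "Const 0 c" p] by simp

lemma dio_comp1:
  assumes "dio p (\<lambda>v. R (v 0))" "diof p f"
  shows "dio p (\<lambda>v. R (f v))"
  using dio_let[of p "\<lambda>v x. R x"] assms by simp

lemma dio_comp2:
  assumes "dio p (\<lambda>v. R (v 0) (v (Suc 0)))" "diof p f" "diof p g"
  shows "dio p (\<lambda>v. R (f v) (g v))"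
proof (rule dio_let[OF _ assms(3)])
  show "dio p (\<lambda>v. R (f (\<lambda>i. v (Suc i))) (v 0))"
    by (rule dio_let[where f = "\<lambda>v. f (\<lambda>i. v (Suc i))" and R = "\<lambda>v x. R x (v 0)",
        OF assms(1) diof_shift[OF assms(2)]])
qed

lemma diof_comp1:
  assumes "dio p (\<lambda>v. v 0 = F (v (Suc 0)))" "diof p f"
  shows "diof p (\<lambda>v. F (f v))"
  unfolding diof_def
  by (rule dio_comp2[of p "\<lambda>x y. x = F y" "\<lambda>v. v 0" "\<lambda>v. f (\<lambda>i. v (Suc i))"])
    (rule assms(1) diof_var diof_shift[OF assms(2)])+

lemma diof_comp2:
  assumes "dio p (\<lambda>v. v 0 = F (v (Suc 0)) (v (Suc (Suc 0))))" "diof p f" "diof p g"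
  shows "diof p (\<lambda>v. F (f v) (g v))"
proof -
  have 1: "dio p (\<lambda>v. v 0 = F (v (Suc 0)) (g (\<lambda>i. v (Suc (Suc i)))))"
  proof (rule dio_let[where R = "\<lambda>v y. v 0 = F (v (Suc 0)) y"])
    show "dio p (\<lambda>v. v (Suc 0) = F (v (Suc (Suc 0))) (v 0))"
      using dio_rename[OF assms(1), of "\<lambda>i. if i = 0 then Suc 0 else if i = Suc 0 then Suc (Suc 0) else 0"] by simp
    show "diof p (\<lambda>v. g (\<lambda>i. v (Suc (Suc i))))"
      using diof_shift[OF diof_shift[OF assms(3)]] by simp
  qed
  show ?thesis unfolding diof_def
  proof (rule dio_let[where R = "\<lambda>v x. v 0 = F x (g (\<lambda>i. v (Suc i)))"])
    show "dio p (\<lambda>v. v (Suc 0) = F (v 0) (g (\<lambda>i. v (Suc (Suc i)))))"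
      using dio_rename[OF 1, of "\<lambda>i. if i = 0 then Suc 0 else if i = Suc 0 then 0 else i"] by simp
    show "diof p (\<lambda>v. f (\<lambda>i. v (Suc i)))"
      by (rule diof_shift[OF assms(2)])
  qed
qed

lemma dio_eq: "diof p f \<Longrightarrow> diof p g \<Longrightarrow> dio p (\<lambda>v. f v = g v)"
  by (rule dio_comp2[of p "\<lambda>x y. x = y"]) (rule dio_eq_var | assumption)+

lemma diof_add: "diof p f \<Longrightarrow> diof p g \<Longrightarrow> diof p (\<lambda>v. f v + g v)"
  by (rule diof_comp2) (use dio_atom[of "Add 0 (Suc 0) (Suc (Suc 0))" p] in simp_all)

lemma diof_mult: "diof p f \<Longrightarrow> diof p g \<Longrightarrow> diof p (\<lambda>v. f v * g v)"
  by (rule diof_comp2) (use dio_atom[of "Mul 0 (Suc 0) (Suc (Suc 0))" p] in simp_all)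

lemma diof_Suc: "diof p f \<Longrightarrow> diof p (\<lambda>v. Suc (f v))"
  using diof_add[OF _ diof_const[of p 1], of f] by simp

lemma diof_pow2: "diof True f \<Longrightarrow> diof True (\<lambda>v. 2 ^ f v)"
  by (rule diof_comp1) (use dio_atom[of "Pow 0 (Suc 0)" True] in simp_all)

lemma dio_le: "diof p f \<Longrightarrow> diof p g \<Longrightarrow> dio p (\<lambda>v. f v \<le> g v)"
  unfolding le_iff_add by (intro dio_ex dio_eq diof_add diof_var diof_shift)

lemma dio_less: "diof p f \<Longrightarrow> diof p g \<Longrightarrow> dio p (\<lambda>v. f v < g v)"
  unfolding Suc_le_eq[symmetric] by (intro dio_le diof_Suc)

lemma dio_dvd: "diof p f \<Longrightarrow> diof p g \<Longrightarrow> dio p (\<lambda>v. f v dvd g v)"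
  unfolding dvd_def by (intro dio_ex dio_eq diof_mult diof_var diof_shift)

lemma dio_True: "dio p (\<lambda>v. True)"
  by (rule dioI[where As = "[]"]) auto

lemma dio_Ball: "finite I \<Longrightarrow> (\<And>i. i \<in> I \<Longrightarrow> dio p (R i)) \<Longrightarrow> dio p (\<lambda>v. \<forall>i\<in>I. R i v)"
  by (induction I rule: finite_induct) (simp_all add: dio_True dio_conj)

text \<open>A conditional equation becomes a plain equation when both sides are multiplied by the
  guard.\<close>

lemma dio_guard_atom:
  assumes "is_Pow a \<Longrightarrow> p"
  shows "dio p (\<lambda>v. v g = 0 \<or> sat v a)"
proof -
  have *: "(z = 0 \<or> x = y) \<longleftrightarrow> z * x = z * y" for x y z :: nat
    by auto
  show ?thesis
  proof (cases a)
    case (Pow i j)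
    then have "diof p (\<lambda>v. 2 ^ v j)"
      using assms diof_pow2[OF diof_var[of True j]] by simp
    then show ?thesis
      unfolding Pow sat.simps * by (intro dio_eq diof_mult diof_var)
  qed (simp only: sat.simps *, intro dio_eq diof_mult diof_add diof_var diof_const)+
qed

lemma dio_guard:
  assumes "dio p R"
  shows "dio p (\<lambda>v. v 0 = 0 \<or> R (\<lambda>i. v (Suc i)))"
proof -
  obtain As n where As: "\<forall>a\<in>set As. is_Pow a \<longrightarrow> p"
    and R: "\<And>v. R v \<longleftrightarrow> (\<exists>w. (\<forall>i<n. w i = v i) \<and> (\<forall>a\<in>set As. sat w a))"
    using assms unfolding dio_def by blast
  have "dio p (\<lambda>w. \<forall>a\<in>set As. w 0 = 0 \<or> sat w (rename Suc a))"
    using As by (intro dio_Ball dio_guard_atom) auto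
  then have "dio p (\<lambda>v. \<exists>w. (\<forall>i<Suc n. w i = v i) \<and> (\<forall>a\<in>set As. w 0 = 0 \<or> sat w (rename Suc a)))"
    by (rule dio_project)
  moreover have "(\<exists>w. (\<forall>i<Suc n. w i = v i) \<and> (\<forall>a\<in>set As. w 0 = 0 \<or> sat w (rename Suc a)))
    \<longleftrightarrow> v 0 = 0 \<or> R (\<lambda>i. v (Suc i))" for v
  proof
    assume "v 0 = 0 \<or> R (\<lambda>i. v (Suc i))"
    then show "\<exists>w. (\<forall>i<Suc n. w i = v i) \<and> (\<forall>a\<in>set As. w 0 = 0 \<or> sat w (rename Suc a))"
    proof
      assume "R (\<lambda>i. v (Suc i))"
      then obtain w where w: "\<forall>i<n. w i = v (Suc i)" "\<forall>a\<in>set As. sat w a"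
        unfolding R by blast
      have "case_nat (v 0) w \<circ> Suc = w" by auto
      then show ?thesis
        using w by (intro exI[of _ "case_nat (v 0) w"]) (auto simp: sat_rename split: nat.splits)
    qed auto
  next
    assume "\<exists>w. (\<forall>i<Suc n. w i = v i) \<and> (\<forall>a\<in>set As. w 0 = 0 \<or> sat w (rename Suc a))"
    then obtain w where w: "\<forall>i<Suc n. w i = v i" "\<forall>a\<in>set As. w 0 = 0 \<or> sat (w \<circ> Suc) a"
      by (auto simp: sat_rename)
    then show "v 0 = 0 \<or> R (\<lambda>i. v (Suc i))"
      unfolding R by (cases "v 0 = 0") (auto intro!: exI[of _ "w \<circ> Suc"])
  qed
  ultimately show ?thesis by simp
qed

text \<open>A system of atoms is a conjunction, so a disjunction is expressed by two guards:
  \<open>b\<close> activates \<open>R\<close>, \<open>c\<close> activates \<open>S\<close>, and the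
  side conditions make exactly one of them nonzero.\<close>

lemma dio_disj:
  assumes "dio p R" "dio p S"
  shows "dio p (\<lambda>v. R v \<or> S v)"
proof -
  have "dio p (\<lambda>v. \<exists>b c::nat. b * c = 0 \<and> (c = 0 \<or> S v) \<and> (b = 0 \<or> R v) \<and> 0 < b + c)"
    using dio_rename[OF dio_guard[OF assms(1)], of "case_nat (Suc 0) (\<lambda>i. Suc (Suc i))"]
      dio_rename[OF dio_guard[OF assms(2)], of "case_nat 0 (\<lambda>i. Suc (Suc i))"]
    by (intro dio_ex dio_conj dio_less diof_add diof_var diof_const dio_eq diof_mult) simp_all
  moreover have "(\<exists>b c::nat. b * c = 0 \<and> (c = 0 \<or> S v) \<and> (b = 0 \<or> R v) \<and> 0 < b + c) \<longleftrightarrow> R v \<or> S v" for v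
  proof
    assume "R v \<or> S v"
    then show "\<exists>b c::nat. b * c = 0 \<and> (c = 0 \<or> S v) \<and> (b = 0 \<or> R v) \<and> 0 < b + c"
    proof
      assume "R v" then show ?thesis by (intro exI[of _ 1] exI[of _ 0]) auto
    next
      assume "S v" then show ?thesis by (intro exI[of _ 0] exI[of _ 1]) auto
    qed
  qed auto
  ultimately show ?thesis by simp
qed

lemmas dio_intros = dio_ex dio_conj dio_disj dio_eq dio_le dio_less dio_dvd
  diof_var diof_const diof_add diof_mult diof_Suc

lemma diof_mod:
  assumes "diof p f" "diof p g"
  shows "diof p (\<lambda>v. f v mod g v)"
proof (rule diof_comp2[OF _ assms])
  \<comment> \<open>The first alternative reflects the convention
    \<open>a mod 0 = a\<close>.\<close>
  have "dio p (\<lambda>v. v (Suc (Suc 0)) = 0 \<and> v 0 = v (Suc 0) \<or>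
     v 0 < v (Suc (Suc 0)) \<and> (\<exists>q. v (Suc 0) = q * v (Suc (Suc 0)) + v 0))"
    by (intro dio_intros)
  moreover have "b = 0 \<and> x = a \<or> x < b \<and> (\<exists>q. a = q * b + x) \<longleftrightarrow> x = a mod b" for a b x :: nat
    by (cases "b = 0") (auto intro!: exI[of _ "a div b"])
  ultimately show "dio p (\<lambda>v. v 0 = v (Suc 0) mod v (Suc (Suc 0)))" by simp
qed

lemma diof_div:
  assumes "diof p f" "diof p g"
  shows "diof p (\<lambda>v. f v div g v)"
proof (rule diof_comp2[OF _ assms])
  have "dio p (\<lambda>v. v (Suc (Suc 0)) = 0 \<and> v 0 = 0 \<or>
     v 0 * v (Suc (Suc 0)) \<le> v (Suc 0) \<and> v (Suc 0) < Suc (v 0) * v (Suc (Suc 0)))"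
    by (intro dio_intros)
  moreover have "b = 0 \<and> x = 0 \<or> x * b \<le> a \<and> a < Suc x * b \<longleftrightarrow> x = a div b" for a b x :: nat
  proof (cases "b = 0")
    case False
    then show ?thesis
      using div_nat_eqI[of b x a] div_times_less_eq_dividend[of a b] dividend_less_div_times[of b a]
      by (auto simp: mult.commute)
  qed auto
  ultimately show "dio p (\<lambda>v. v 0 = v (Suc 0) div v (Suc (Suc 0)))" by simp
qed

section \<open>Powers, binomial coefficients and factorials\<close>

text \<open>Powers of an arbitrary base are reduced to powers of 2: modulo
  \<open>d = 2 ^ n - a\<close> the number \<open>2 ^ n\<close> is \<open>a\<close>, hence
  \<open>2 ^ (n * b)\<close> is \<open>a ^ b\<close>, and \<open>n\<close> is large enough for
  \<open>a ^ b < d\<close>.\<close>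

lemma power_eq_mod:
  fixes a b :: nat
  defines "n \<equiv> a * b + a + 1"
  assumes d: "d + a = 2 ^ n"
  shows "a ^ b = 2 ^ (n * b) mod d"
proof -
  have "[a = 2 ^ n] (mod d)"
    unfolding d[symmetric] by (simp add: cong_def)
  then have "[a ^ b = 2 ^ (n * b)] (mod d)"
    unfolding power_mult by (rule cong_pow)
  moreover have "a ^ b < d"
  proof -
    have "a ^ b \<le> 2 ^ (a * b)"
      unfolding power_mult by (intro power_mono) (use less_exp[of a] in simp_all)
    moreover have "a < 2 ^ a" by simp
    moreover have "(2::nat) ^ n = 2 ^ (a * b) * 2 ^ a + 2 ^ (a * b) * 2 ^ a"
      by (simp add: n_def power_add)
    moreover have "(2::nat) ^ (a * b) \<le> 2 ^ (a * b) * 2 ^ a" "(2::nat) ^ a \<le> 2 ^ (a * b) * 2 ^ a"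
      by simp_all
    ultimately have "a ^ b + a < 2 ^ n" by linarith
    then show ?thesis using d by simp
  qed
  ultimately show ?thesis
    by (simp add: cong_def)
qed

lemma diof_power:
  assumes "diof True f" "diof True g"
  shows "diof True (\<lambda>v. f v ^ g v)"
proof (rule diof_comp2[OF _ assms])
  have "dio True (\<lambda>v. \<exists>d. d + v (Suc 0) = 2 ^ (v (Suc 0) * v (Suc (Suc 0)) + v (Suc 0) + 1) \<and>
     v 0 = 2 ^ ((v (Suc 0) * v (Suc (Suc 0)) + v (Suc 0) + 1) * v (Suc (Suc 0))) mod d)"
    by (intro dio_intros diof_mod diof_pow2)
  moreover have "(\<exists>d. d + a = 2 ^ (a * b + a + 1) \<and> x = 2 ^ ((a * b + a + 1) * b) mod d) \<longleftrightarrow> x = a ^ b"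
    for a b x :: nat
  proof -
    have "a \<le> 2 ^ (a * b + a + 1)"
      using less_exp[of a] power_increasing[of a "a * b + a + 1" "2::nat"] by linarith
    then obtain d where "d + a = 2 ^ (a * b + a + 1)"
      by (metis le_add_diff_inverse2)
    then show ?thesis
      using power_eq_mod[of _ a b] by metis
  qed
  ultimately show "dio True (\<lambda>v. v 0 = v (Suc 0) ^ v (Suc (Suc 0)))" by simp
qed

lemma digit_eq_div_mod:
  fixes u :: nat
  assumes "\<And>i. c i < u" "k < m"
  shows "(\<Sum>i<m. c i * u ^ i) div u ^ k mod u = c k"
  using assms
proof (induction k arbitrary: c m)
  case (0 c m)
  then obtain m' where m: "m = Suc m'" by (cases m) auto
  have "(\<Sum>i<m. c i * u ^ i) = c 0 + u * (\<Sum>i<m'. c (Suc i) * u ^ i)"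
    unfolding m sum.lessThan_Suc_shift by (simp add: sum_distrib_left mult_ac)
  then show ?case using 0(1)[of 0] by simp
next
  case (Suc k c m)
  then obtain m' where m: "m = Suc m'" by (cases m) auto
  have "u > 0" using Suc(2)[of 0] by simp
  have "(\<Sum>i<m. c i * u ^ i) = c 0 + u * (\<Sum>i<m'. c (Suc i) * u ^ i)"
    unfolding m sum.lessThan_Suc_shift by (simp add: sum_distrib_left mult_ac)
  then have "(\<Sum>i<m. c i * u ^ i) div u ^ Suc k = (\<Sum>i<m'. c (Suc i) * u ^ i) div u ^ k"
    using Suc(2)[of 0] \<open>u > 0\<close> by (simp add: div_mult2_eq)
  then show ?case
    using Suc.IH[of "\<lambda>i. c (Suc i)" m'] Suc.prems m by simp
qed

text \<open>In base \<open>2 ^ (n + 1)\<close>, which exceeds every coefficient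
  \<open>n choose i\<close>, the binomial expansion of \<open>(base + 1) ^ n\<close> displays these
  coefficients as digits.\<close>

lemma binomial_eq_digit:
  "n choose k = (2 ^ (n + 1) + 1) ^ n div (2 ^ (n + 1)) ^ k mod 2 ^ (n + 1)"
proof -
  have "(2 ^ (n + 1) + 1) ^ n = (\<Sum>i\<le>n. (n choose i) * (2 ^ (n + 1)) ^ i)"
    by (simp only: binomial of_nat_id power_one mult_1_right)
  \<comment> \<open>Zero terms are appended so that \<open>k\<close> is a digit position even if
    \<open>k > n\<close>.\<close>
  also have "\<dots> = (\<Sum>i<n + k + 1. (n choose i) * (2 ^ (n + 1)) ^ i)"
    by (rule sum.mono_neutral_left) (auto simp: not_le binomial_eq_0)
  finally show ?thesis
    using digit_eq_div_mod[of "\<lambda>i. n choose i" "2 ^ (n + 1)" k "n + k + 1"]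
    by (simp add: le_less_trans[OF binomial_le_pow2])
qed

lemma diof_choose:
  assumes "diof True f" "diof True g"
  shows "diof True (\<lambda>v. f v choose g v)"
  unfolding binomial_eq_digit using assms
  by (intro diof_mod diof_div diof_power diof_pow2 diof_add diof_const)

lemma Suc_times_binomial_eq_diff: "Suc k * (n choose Suc k) = (n - k) * (n choose k)"
  by (simp only: binomial_absorption binomial_absorb_comp)

lemma fact_Suc_times_binomial: "fact (Suc k) * (n choose Suc k) = (n - k) * (fact k * (n choose k))"
proof -
  have "fact (Suc k) * (n choose Suc k) = fact k * (Suc k * (n choose Suc k))"
    by (simp only: fact_Suc of_nat_id mult_ac)
  then show ?thesis
    by (simp only: Suc_times_binomial_eq_diff mult_ac)
qed

text \<open>The falling factorial \<open>r (r - 1) ... (r - k + 1)\<close> is at least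
  \<open>r ^ k * (1 - k * k / r)\<close>, an estimate of Bernoulli type. It is multiplied by
  \<open>r\<close> and stated over \<open>int\<close> to avoid fractions and truncated
  subtraction.\<close>

lemma fact_binomial_lower:
  "k \<le> r \<Longrightarrow> int r ^ k * (int r - int (k * k)) \<le> int (fact k * (r choose k)) * int r"
proof (induction k)
  case (Suc k)
  have "int r * (int r - int (Suc k * Suc k)) \<le> (int r - int k) * (int r - int (k * k))"
    by (simp add: algebra_simps)
  then have "int r ^ k * (int r * (int r - int (Suc k * Suc k))) \<le>
      int r ^ k * ((int r - int k) * (int r - int (k * k)))"
    by (intro mult_left_mono) simp_all
  also have "\<dots> = (int r - int k) * (int r ^ k * (int r - int (k * k)))"
    by (simp add: algebra_simps)
  also have "\<dots> \<le> (int r - int k) * (int (fact k * (r choose k)) * int r)"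
    using Suc by (intro mult_left_mono) simp_all
  also have "\<dots> = int (fact (Suc k) * (r choose Suc k)) * int r"
    using Suc.prems unfolding fact_Suc_times_binomial by (simp add: of_nat_diff algebra_simps)
  finally show ?case by (simp add: algebra_simps)
qed simp

text \<open>The quotient of \<open>r ^ k\<close> by \<open>r choose k\<close> tends to
  \<open>fact k\<close> from above as \<open>r\<close> grows; the bound on \<open>r\<close> brings
  it below \<open>fact k + 1\<close>.\<close>

lemma fact_eq_div_binomial:
  assumes "k * k * (fact k + 1) + k < r"
  shows "fact k = r ^ k div (r choose k)"
proof (rule div_nat_eqI[symmetric])
  show "(r choose k) * fact k \<le> r ^ k"
    by (rule binomial_fact_pow)
  have r: "k \<le> r" "0 < r" using assms by auto
  have "int (fact k) * int r < (int (fact k) + 1) * (int r - int (k * k))"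
  proof -
    have "(fact k + 1) * (k * k) < r"
      using assms by (simp add: algebra_simps)
    then have "int ((fact k + 1) * (k * k)) < int r"
      by (simp only: of_nat_less_iff)
    then show ?thesis by (simp add: algebra_simps)
  qed
  then have "int r ^ k * (int (fact k) * int r) < int r ^ k * ((int (fact k) + 1) * (int r - int (k * k)))"
    using r by simp
  also have "\<dots> = (int (fact k) + 1) * (int r ^ k * (int r - int (k * k)))"
    by (simp only: mult_ac)
  also have "\<dots> \<le> (int (fact k) + 1) * (int (fact k * (r choose k)) * int r)"
    using fact_binomial_lower[OF r(1)] by (intro mult_left_mono) simp_all
  finally have "int (fact k * r ^ k * r) < int (fact k * ((fact k + 1) * (r choose k)) * r)"
    by (simp add: algebra_simps)
  then have "fact k * r ^ k * r < fact k * ((fact k + 1) * (r choose k)) * r"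
    by (simp only: of_nat_less_iff)
  then show "r ^ k < (r choose k) * Suc (fact k)"
    by (simp add: mult.commute)
qed

text \<open>The bound on \<open>r\<close> mentions the factorial that is to be defined;
  \<open>k ^ k\<close> replaces it and makes \<open>r\<close> explicit.\<close>

lemma fact_eq:
  fixes k :: nat
  shows "fact k = (k * k * (k ^ k + 1) + k + 1) ^ k div ((k * k * (k ^ k + 1) + k + 1) choose k)"
proof (rule fact_eq_div_binomial)
  have "fact k \<le> k ^ k"
    using fact_le_power[of k, where ?'a = nat] by simp
  then have "k * k * (fact k + 1) \<le> k * k * (k ^ k + 1)"
    by (intro mult_left_mono add_right_mono) simp_all
  then show "k * k * (fact k + 1) + k < k * k * (k ^ k + 1) + k + 1"
    by linarith
qed

lemma diof_fact: "diof True f \<Longrightarrow> diof True (\<lambda>v. fact (f v))"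
  unfolding fact_eq by (intro diof_div diof_power diof_choose diof_add diof_mult diof_const)

section \<open>Eliminating a bounded universal quantifier\<close>

lemma fact_mult_binomial: "fact k * (n choose k) = (\<Prod>i<k. n - i)"
proof (induction k)
  case (Suc k)
  then show ?case
    unfolding fact_Suc_times_binomial by (simp add: mult.commute)
qed simp

text \<open>A prime dividing \<open>w choose u\<close> divides the falling factorial and hence some
  \<open>w - i\<close> with \<open>i < u\<close>. Divisibility of a binomial coefficient thus
  expresses that a residue is small. If \<open>w < u\<close>, then \<open>w\<close> itself is the
  small residue.\<close>

lemma prime_dvd_binomial_cong:
  fixes p :: nat
  assumes "prime p" "p dvd w choose u"
  shows "\<exists>v<u. [w = v] (mod p)"
proof (cases "w < u")
  case False
  have "p dvd (\<Prod>i<u. w - i)"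
    using assms(2) by (simp flip: fact_mult_binomial)
  then obtain i where "i < u" "p dvd w - i"
    using assms(1) by (auto simp: prime_dvd_prod_iff)
  moreover from this have "[w = i] (mod p)"
    using False by (simp add: cong_altdef_nat)
  ultimately show ?thesis by blast
qed auto

lemma not_coprime_prime:
  fixes a b :: nat
  assumes "\<not> coprime a b"
  obtains p where "prime p" "p dvd a" "p dvd b"
proof -
  have "gcd a b \<noteq> 1" using assms by (simp add: coprime_iff_gcd_eq_1)
  then obtain p where "prime p" "p dvd gcd a b" using prime_factor_nat by blast
  then show ?thesis using that by simp
qed

text \<open>With \<open>B = fact T * fact T - 1\<close> one gets
  \<open>B - k = (k + 1) * m k\<close>, so that the denominators cancel in \<open>B choose N\<close>
  and it becomes the product of the \<open>m k\<close> with \<open>k < N\<close>. The condition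
  \<open>3 \<le> T\<close> ensures that every \<open>m k\<close> is at least 2 and has a prime
  factor.\<close>

locale binomial_modulus =
  fixes T N :: nat
  assumes N: "N \<le> T" and T: "3 \<le> T"
begin

definition B :: nat where "B = fact T * fact T - 1"

definition m :: "nat \<Rightarrow> nat" where "m k = fact T * fact T div (k + 1) - 1"

lemma fact_ge: "T \<le> fact T"
  by (rule fact_ge_self)

lemma quotient:
  assumes "k < N"
  shows "(k + 1) * (fact T * fact T div (k + 1)) = fact T * fact T" "3 \<le> fact T * fact T div (k + 1)"
proof -
  have k: "k + 1 \<le> T" using assms N by simp
  have d: "k + 1 dvd fact T" using k by (intro dvd_fact) auto
  show eq: "(k + 1) * (fact T * fact T div (k + 1)) = fact T * fact T"
    using d by (intro dvd_mult_div_cancel) simp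
  have "fact T * (k + 1) \<le> fact T * fact T"
    using k fact_ge by (intro mult_left_mono) auto
  then have "fact T \<le> fact T * fact T div (k + 1)"
    by (simp only: less_eq_div_iff_mult_less_eq[of "k + 1"])
  then show "3 \<le> fact T * fact T div (k + 1)"
    using fact_ge T by linarith
qed

lemma B_minus: "k < N \<Longrightarrow> B - k = (k + 1) * m k"
  using quotient[of k] unfolding B_def m_def by (simp add: diff_mult_distrib2 del: add_Suc_right)

lemma B_ge: "N \<le> B"
proof -
  have "T * 3 \<le> fact T * fact T"
    using fact_ge T by (intro mult_mono) auto
  then show ?thesis using N T unfolding B_def by linarith
qed

lemma B_cong: "k < N \<Longrightarrow> [B = k] (mod m k)"
  using B_minus[of k] B_ge by (simp add: cong_altdef_nat)

lemma binomial_eq_prod: "n \<le> N \<Longrightarrow> B choose n = (\<Prod>k<n. m k)"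
proof (induction n)
  case (Suc n)
  have "Suc n * (B choose Suc n) = (B - n) * (B choose n)"
    by (rule Suc_times_binomial_eq_diff)
  also have "\<dots> = Suc n * (m n * (B choose n))"
    using B_minus[of n] Suc.prems by (simp add: algebra_simps)
  finally have "B choose Suc n = m n * (B choose n)"
    by (simp only: nat_mult_eq_cancel_disj) simp
  then show ?case using Suc by (simp add: mult.commute)
qed simp

text \<open>Here the factorial has to be squared: one copy absorbs \<open>k + 1\<close> and the
  other still contains every prime up to \<open>T\<close>. Such a prime divides
  \<open>m k + 1\<close>, so it cannot divide \<open>m k\<close>.\<close>

lemma prime_dvd_m:
  assumes "k < N" "prime p" "p dvd m k"
  shows "T < p"
proof (rule ccontr)
  assume "\<not> T < p"
  then have "p dvd fact T"
    using assms(2) by (simp add: prime_dvd_fact_iff)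
  moreover have "k + 1 dvd fact T"
    using assms(1) N by (intro dvd_fact) auto
  ultimately have "(k + 1) * p dvd fact T * fact T"
    by (rule mult_dvd_mono[rotated])
  then have "(k + 1) * p dvd (k + 1) * (fact T * fact T div (k + 1))"
    by (simp only: quotient(1)[OF assms(1)])
  then have "p dvd fact T * fact T div (k + 1)"
    by (simp only: nat_mult_dvd_cancel_disj) simp
  then have "p dvd fact T * fact T div (k + 1) - m k"
    using assms(3) by (rule dvd_diff_nat)
  also have "fact T * fact T div (k + 1) - m k = 1"
    using quotient(2)[OF assms(1)] by (simp add: m_def)
  finally show False using assms(2) by simp
qed

lemma obtain_prime:
  assumes "k < N"
  obtains p where "prime p" "p dvd m k"
proof -
  have "m k \<noteq> 1" using quotient(2)[OF assms] by (simp add: m_def)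
  then show ?thesis using that prime_factor_nat by blast
qed

text \<open>A common prime of \<open>m j\<close> and \<open>m k\<close> divides \<open>B - j\<close>
  and \<open>B - k\<close>, hence the difference of the indices, which is below \<open>N\<close>;
  but it exceeds \<open>T\<close>.\<close>

lemma coprime_m:
  assumes "j < N" "k < N" "j \<noteq> k"
  shows "coprime (m j) (m k)"
proof -
  have less: "coprime (m j) (m k)" if "j < k" "k < N" for j k
  proof (rule ccontr)
    assume "\<not> coprime (m j) (m k)"
    then obtain p where p: "prime p" "p dvd m j" "p dvd m k"
      using not_coprime_prime by blast
    then have "p dvd B - j" "p dvd B - k"
      using B_minus[of j] B_minus[of k] that by simp_all
    then have "p dvd (B - j) - (B - k)" by (rule dvd_diff_nat)
    moreover have "(B - j) - (B - k) = k - j" using B_ge that by simp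
    ultimately have "p \<le> k - j" using that by (simp add: dvd_imp_le)
    then show False using prime_dvd_m[OF _ p(1,3)] that N by simp
  qed
  show ?thesis
    using less[of j k] less[of k j, THEN coprime_commute[THEN iffD1]] assms
    by (cases "j < k") simp_all
qed

lemma cong_binomialI: "(\<And>k. k < N \<Longrightarrow> [x = y] (mod m k)) \<Longrightarrow> [x = y] (mod (B choose N))"
  unfolding binomial_eq_prod[OF order_refl] by (rule coprime_cong_prod_nat) (auto intro: coprime_m)

lemma m_dvd: "k < N \<Longrightarrow> m k dvd (B choose N)"
  unfolding binomial_eq_prod[OF order_refl] by (intro dvd_prodI) auto

lemma crt: "\<exists>x. \<forall>k<N. [x = y k] (mod m k)"
  using chinese_remainder_nat[of "{..<N}" m y] coprime_m by auto

text \<open>The converse encoding: each \<open>m k\<close> divides a factor of the falling factorial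
  \<open>fact U * (w choose U)\<close>, and \<open>fact U\<close> can be cancelled because all
  primes of the modulus exceed \<open>T\<close>.\<close>

lemma dvd_binomialI:
  assumes "U \<le> T" "\<And>k. k < N \<Longrightarrow> \<exists>v<U. [w = v] (mod m k)"
  shows "(B choose N) dvd (w choose U)"
proof (cases "w < U")
  case False
  have "[fact U * (w choose U) = 0] (mod (B choose N))"
  proof (rule cong_binomialI)
    fix k assume k: "k < N"
    then obtain v where v: "v < U" "[w = v] (mod m k)" using assms(2) by blast
    then have "m k dvd w - v"
      using False by (simp add: cong_altdef_nat)
    also have "w - v dvd (\<Prod>i<U. w - i)"
      using v(1) dvd_prodI[of "{..<U}" v "\<lambda>i. w - i"] by simp
    finally (dvd_trans) have "m k dvd (\<Prod>i<U. w - i)" .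
    then show "[fact U * (w choose U) = 0] (mod m k)"
      unfolding fact_mult_binomial by (simp add: cong_0_iff)
  qed
  moreover have "coprime (B choose N) (fact U)"
  proof (rule ccontr)
    assume "\<not> coprime (B choose N) (fact U)"
    then obtain p where p: "prime p" "p dvd (B choose N)" "p dvd fact U"
      using not_coprime_prime by blast
    then obtain k where k: "k < N" "p dvd m k"
      unfolding binomial_eq_prod[OF order_refl] by (auto simp: prime_dvd_prod_iff)
    have "p \<le> U" using p by (simp add: prime_dvd_fact_iff)
    then show False using prime_dvd_m[OF k(1) p(1) k(2)] assms(1) by simp
  qed
  ultimately show ?thesis
    by (simp add: cong_0_iff coprime_dvd_mult_right_iff)
qed (simp add: binomial_eq_0)

end

text \<open>\<open>Pow\<close> gets a default value, since it has no meaning for residues; the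
  decoding in \<open>sat_mod_imp_sat\<close> is for the other atoms.\<close>

fun sat_mod :: "nat \<Rightarrow> (nat \<Rightarrow> nat) \<Rightarrow> atom \<Rightarrow> bool" where
  "sat_mod M v (Const i c) \<longleftrightarrow> [v i = c] (mod M)"
| "sat_mod M v (Add i j k) \<longleftrightarrow> [v i = v j + v k] (mod M)"
| "sat_mod M v (Mul i j k) \<longleftrightarrow> [v i = v j * v k] (mod M)"
| "sat_mod M v (Pow i j) \<longleftrightarrow> True"

fun vars :: "atom \<Rightarrow> nat set" where
  "vars (Const i c) = {i}"
| "vars (Add i j k) = {i, j, k}"
| "vars (Mul i j k) = {i, j, k}"
| "vars (Pow i j) = {i, j}"

fun const_of :: "atom \<Rightarrow> nat" where
  "const_of (Const i c) = c"
| "const_of _ = 0"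

lemma finite_vars: "finite (vars a)"
  by (cases a) auto

lemma sat_mod_transfer:
  assumes "sat_mod M w a" "\<And>i. i \<in> vars a \<Longrightarrow> [v i = w i] (mod M)"
  shows "sat_mod M v a"
proof (cases a)
  case (Const i c)
  then show ?thesis using assms cong_trans by auto
next
  case (Add i j k)
  have "[v i = w i] (mod M)" "[w i = w j + w k] (mod M)" "[w j + w k = v j + v k] (mod M)"
    using assms Add by (auto intro: cong_add cong_sym)
  then show ?thesis unfolding Add sat_mod.simps by (blast intro: cong_trans)
next
  case (Mul i j k)
  have "[v i = w i] (mod M)" "[w i = w j * w k] (mod M)" "[w j * w k = v j * v k] (mod M)"
    using assms Mul by (auto intro: cong_mult cong_sym)
  then show ?thesis unfolding Mul sat_mod.simps by (blast intro: cong_trans)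
qed auto

lemma sat_imp_sat_mod: "sat v a \<Longrightarrow> sat_mod M v a"
  by (cases a) auto

lemma sat_mod_dvd: "sat_mod M v a \<Longrightarrow> d dvd M \<Longrightarrow> sat_mod d v a"
  by (cases a) (auto intro: cong_dvd_modulus_nat)

text \<open>If the variables are below \<open>U\<close>, both sides of each equation are below
  \<open>M\<close>: the terms \<open>U * U\<close>, \<open>2 * U\<close> and \<open>C\<close>
  account for products, sums and constants. Congruent numbers below the modulus are equal.\<close>

lemma sat_mod_imp_sat:
  assumes "sat_mod M v a" "\<not> is_Pow a" "\<And>i. i \<in> vars a \<Longrightarrow> v i < U"
    "const_of a \<le> C" "U * U + 2 * U + C < M"
  shows "sat v a"
proof (cases a)
  case (Const i c)
  then show ?thesis
    using assms by (auto intro!: cong_less_modulus_unique_nat[of _ _ M] dest: assms(3))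
next
  case (Add i j k)
  then have "v i < U" "v j < U" "v k < U" using assms(3) by auto
  then have "v i < M" "v j + v k < M" using assms(5) by linarith+
  then show ?thesis
    using assms(1) Add by (auto intro!: cong_less_modulus_unique_nat[of _ _ M])
next
  case (Mul i j k)
  then have v: "v i < U" "v j < U" "v k < U" using assms(3) by auto
  then have "v j * v k \<le> U * U" by (intro mult_mono) auto
  then have "v i < M" "v j * v k < M" using assms(5) v by linarith+
  then show ?thesis
    using assms(1) Mul by (auto intro!: cong_less_modulus_unique_nat[of _ _ M])
qed (use assms in auto)

text \<open>Since \<open>B\<close> is congruent to \<open>k\<close> modulo the \<open>k\<close>-th factor of \<open>B choose N\<close>, the number \<open>W 0 = B\<close> plays
  the role of all \<open>k < N\<close> at once, and by the Chinese remainder theorem \<open>W i\<close> does so for the witnesses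
  of the \<open>i\<close>-th variable. That \<open>B choose N\<close> divides \<open>W i choose U\<close> says that these witnesses are less
  than \<open>U\<close>, hence too small for a congruence modulo a large prime to hold without equality.\<close>

lemma bounded_forall_iff:
  fixes N C n l :: nat and e :: "nat \<Rightarrow> nat"
  defines "T \<equiv> \<lambda>U. U * U + 2 * U + C + 3"
  defines "M \<equiv> \<lambda>U. (fact (T U) * fact (T U) - 1) choose N"
  assumes As: "\<And>a. a \<in> set As \<Longrightarrow> \<not> is_Pow a" "\<And>a. a \<in> set As \<Longrightarrow> vars a \<subseteq> {..<l}"
      "\<And>a. a \<in> set As \<Longrightarrow> const_of a \<le> C" and n: "0 < n"
  shows "(\<forall>k<N. \<exists>x. (\<forall>i<n. x i = case_nat k e i) \<and> (\<forall>a\<in>set As. sat x a)) \<longleftrightarrow>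
    (\<exists>U W. N \<le> U \<and> W 0 = fact (T U) * fact (T U) - 1 \<and>
       (\<forall>i\<in>{1..<n}. W i = e (i - 1) \<and> W i < U) \<and>
       (\<forall>i\<in>{n..<l}. M U dvd (W i choose U)) \<and> (\<forall>a\<in>set As. sat_mod (M U) W a))"
    (is "?L \<longleftrightarrow> (\<exists>U W. ?R U W)")
proof
  assume "\<exists>U W. ?R U W"
  then obtain U W where U: "N \<le> U" and W0: "W 0 = fact (T U) * fact (T U) - 1"
    and We: "\<And>i. i \<in> {1..<n} \<Longrightarrow> W i = e (i - 1) \<and> W i < U"
    and WU: "\<And>i. i \<in> {n..<l} \<Longrightarrow> M U dvd (W i choose U)"
    and sat: "\<And>a. a \<in> set As \<Longrightarrow> sat_mod (M U) W a" by blast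
  interpret binomial_modulus "T U" N
    using U by unfold_locales (auto simp: T_def)
  have M: "M U = B choose N" by (simp add: M_def B_def)
  show ?L
  proof (intro allI impI)
    fix k assume k: "k < N"
    \<comment> \<open>Decoding uses one prime factor of \<open>m k\<close>, because primality is
      what singles out a factor of the falling factorial; this prime still exceeds
      \<open>T U\<close>.\<close>
    obtain p where p: "prime p" "p dvd m k" using obtain_prime[OF k] .
    have pM: "p dvd M U" using p(2) m_dvd[OF k] unfolding M by (rule dvd_trans)
    have pT: "T U < p" using prime_dvd_m[OF k p] .
    have "\<exists>v<U. [v = W i] (mod p) \<and> (i < n \<longrightarrow> v = case_nat k e i)" if il: "i < l" for i
    proof -
      consider "i = 0" | "i \<in> {1..<n}" | "i \<in> {n..<l}" using il n by (cases "i = 0"; cases "i < n") auto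
      then show ?thesis
      proof cases
        case 1
        have "[W 0 = k] (mod p)"
          using B_cong[OF k] p(2) unfolding W0 B_def by (rule cong_dvd_modulus_nat)
        then show ?thesis using 1 U k by (auto intro!: exI[of _ k] cong_sym)
      next
        case 2
        then show ?thesis using We[OF 2] by (auto intro!: exI[of _ "W i"] split: nat.splits)
      next
        case 3
        obtain v where "v < U" "[W i = v] (mod p)"
          using prime_dvd_binomial_cong[OF p(1) dvd_trans[OF pM WU[OF 3]]] by blast
        then show ?thesis using 3 by (auto intro!: exI[of _ v] cong_sym)
      qed
    qed
    then obtain x where x: "\<And>i. i < l \<Longrightarrow> x i < U \<and> [x i = W i] (mod p) \<and> (i < n \<longrightarrow> x i = case_nat k e i)"
      by metis
    \<comment> \<open>The first \<open>n\<close> coordinates are prescribed even where they lie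
      beyond \<open>l\<close>.\<close>
    define y where "y i = (if i < n then case_nat k e i else x i)" for i
    have yx: "i < l \<Longrightarrow> y i = x i" for i using x by (simp add: y_def)
    have "sat y a" if a: "a \<in> set As" for a
    proof (rule sat_mod_imp_sat)
      show "sat_mod p y a"
        using sat_mod_dvd[OF sat[OF a] pM]
        by (rule sat_mod_transfer) (use As(2)[OF a] x yx in auto)
      show "y i < U" if "i \<in> vars a" for i
        using As(2)[OF a] that x yx by auto
      show "U * U + 2 * U + C < p" using pT by (simp add: T_def)
    qed (use As a in auto)
    then show "\<exists>x. (\<forall>i<n. x i = case_nat k e i) \<and> (\<forall>a\<in>set As. sat x a)"
      by (intro exI[of _ y]) (simp add: y_def)
  qed
next
  assume ?L
  then obtain x where x: "\<And>k i. k < N \<Longrightarrow> i < n \<Longrightarrow> x k i = case_nat k e i"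
    and sat: "\<And>k a. k < N \<Longrightarrow> a \<in> set As \<Longrightarrow> sat (x k) a" by metis
  \<comment> \<open>\<open>U\<close> dominates \<open>N\<close>, the parameters and the witnesses
    for all \<open>k < N\<close> at once.\<close>
  define U where "U = N + (\<Sum>i<n. Suc (e i)) + (\<Sum>k<N. \<Sum>i<l. Suc (x k i))"
  have U: "N \<le> U" by (simp add: U_def)
  have Ue: "e i < U" if "i < n" for i
    using member_le_sum[of i "{..<n}" "\<lambda>i. Suc (e i)"] that by (simp add: U_def)
  have Ux: "x k i < U" if "k < N" "i < l" for k i
  proof -
    have "Suc (x k i) \<le> (\<Sum>i<l. Suc (x k i))"
      using member_le_sum[of i "{..<l}" "\<lambda>i. Suc (x k i)"] that by simp
    also have "\<dots> \<le> (\<Sum>k<N. \<Sum>i<l. Suc (x k i))"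
      using member_le_sum[of k "{..<N}" "\<lambda>k. \<Sum>i<l. Suc (x k i)"] that by simp
    finally show ?thesis by (simp add: U_def)
  qed
  interpret binomial_modulus "T U" N
    using U by unfold_locales (auto simp: T_def)
  have M: "M U = B choose N" by (simp add: M_def B_def)
  obtain W' where W': "\<And>i k. k < N \<Longrightarrow> [W' i = x k i] (mod m k)"
    using crt[of "\<lambda>k. x k _"] by metis
  \<comment> \<open>Parameters keep their true values; only the witnesses are merged by the Chinese
    remainder theorem.\<close>
  define W where "W i = (if i = 0 then B else if i < n then e (i - 1) else W' i)" for i
  have Wx: "[W i = x k i] (mod m k)" if "k < N" for i k
    using that n B_cong[OF that] W'[OF that] x[OF that]
    by (cases i) (auto simp: W_def)
  have "?R U W"
  proof (intro conjI ballI)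
    show "N \<le> U" by fact
    show "W 0 = fact (T U) * fact (T U) - 1" by (simp add: W_def B_def)
    show "W i = e (i - 1)" "W i < U" if "i \<in> {1..<n}" for i
      using that Ue[of "i - 1"] by (auto simp: W_def)
    show "M U dvd (W i choose U)" if "i \<in> {n..<l}" for i
      unfolding M
    proof (rule dvd_binomialI)
      show "U \<le> T U" by (simp add: T_def)
      show "\<exists>v<U. [W i = v] (mod m k)" if "k < N" for k
        using Wx[OF that, of i] Ux[OF that, of i] \<open>i \<in> {n..<l}\<close> by auto
    qed
    show "sat_mod (M U) W a" if a: "a \<in> set As" for a
    proof -
      have "sat_mod (m k) W a" if "k < N" for k
        using sat_imp_sat_mod[OF sat[OF that a]] by (rule sat_mod_transfer) (rule Wx[OF that])
      then show ?thesis
        unfolding M by (cases a) (auto intro: cong_binomialI)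
    qed
  qed
  then show "\<exists>U W. ?R U W" by blast
qed

lemma dio_sat_mod:
  assumes "\<not> is_Pow a"
  shows "dio p (\<lambda>v. sat_mod (v i) (\<lambda>j. v (r j)) a)"
  using assms by (cases a) (auto simp: cong_def intro!: dio_eq diof_mod diof_add diof_mult diof_var diof_const)

text \<open>The flag rises from \<open>False\<close> to \<open>True\<close>: the body must survive
  reduction modulo \<open>B choose N\<close>, while describing that modulus takes powers of
  2.\<close>

theorem dio_bounded_forall:
  assumes "dio False (\<lambda>v. R (\<lambda>i. v (Suc i)) (v 0))" "diof True f"
  shows "dio True (\<lambda>v. \<forall>k<f v. R v k)"
proof (rule dio_let[OF _ assms(2)])
  obtain As n where n: "n \<ge> 1" and As: "\<forall>a\<in>set As. \<not> is_Pow a"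
    and "\<And>v. R (\<lambda>i. v (Suc i)) (v 0) \<longleftrightarrow> (\<exists>x. (\<forall>i<n. x i = v i) \<and> (\<forall>a\<in>set As. sat x a))"
    using dio_rename_at_least[OF assms(1), of 1 "\<lambda>i. i"] by auto
  from this(3)[of "case_nat _ _"]
  have R: "\<And>e k. R e k \<longleftrightarrow> (\<exists>x. (\<forall>i<n. x i = case_nat k e i) \<and> (\<forall>a\<in>set As. sat x a))"
    by simp
  have "finite (\<Union>a\<in>set As. vars a)" by (simp add: finite_vars)
  then obtain l where l: "\<And>a i. a \<in> set As \<Longrightarrow> i \<in> vars a \<Longrightarrow> i < l"
    unfolding finite_nat_set_iff_bounded by blast
  have "finite (const_of ` set As)" by simp
  then obtain C where C: "\<And>a. a \<in> set As \<Longrightarrow> const_of a \<le> C"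
    unfolding finite_nat_set_iff_bounded_le by blast
  \<comment> \<open>Under the quantifiers introduced below, coordinates 0 to 3 are \<open>M\<close>,
    \<open>B\<close>, \<open>T\<close>, \<open>U\<close>, coordinate 4 is the bound
    \<open>N\<close>, and the parameters start at 5. Hence \<open>W 0 = B\<close> is read at 1 and
    every other \<open>W i\<close> at \<open>i + 4\<close>, which for \<open>i < n\<close> is the
    place of the parameter \<open>e (i - 1)\<close>.\<close>
  define r where "r i = (if i = 0 then 1 else i + 4)" for i :: nat
  let ?S = "\<lambda>w. (\<forall>i\<in>{1..<n}. w (i + 4) < w 3) \<and> (\<forall>i\<in>{n..<l}. w 0 dvd (w (i + 4) choose w 3)) \<and>
     (\<forall>a\<in>set As. sat_mod (w 0) (\<lambda>i. w (r i)) a)"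
  let ?H = "\<lambda>M B U e. \<exists>W. W 0 = B \<and> (\<forall>i\<in>{1..<n}. W i = e (i - 1) \<and> W i < U) \<and>
       (\<forall>i\<in>{n..<l}. M dvd (W i choose U)) \<and> (\<forall>a\<in>set As. sat_mod M W a)"
  have "dio True ?S"
    using As by (intro dio_conj dio_Ball dio_less dio_dvd diof_choose diof_var dio_sat_mod) auto
  then have "dio True (\<lambda>v. \<exists>w. (\<forall>i<n + 4. w i = v i) \<and> ?S w)"
    by (rule dio_project)
  moreover have "(\<exists>w. (\<forall>i<n + 4. w i = v i) \<and> ?S w) \<longleftrightarrow> ?H (v 0) (v 1) (v 3) (\<lambda>i. v (i + 5))" for v
  proof
    assume "\<exists>w. (\<forall>i<n + 4. w i = v i) \<and> ?S w"
    then obtain w where w: "\<And>i. i < n + 4 \<Longrightarrow> w i = v i" "?S w" by blast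
    show "?H (v 0) (v 1) (v 3) (\<lambda>i. v (i + 5))"
      using w(2) n w(1)[of 0] w(1)[of 1] w(1)[of 3]
      by (intro exI[of _ "\<lambda>i. w (r i)"]) (auto simp: r_def w(1) Suc_diff_le add.commute)
  next
    assume "?H (v 0) (v 1) (v 3) (\<lambda>i. v (i + 5))"
    then obtain W where W: "W 0 = v 1" "\<forall>i\<in>{1..<n}. W i = v (i - 1 + 5) \<and> W i < v 3"
      "\<forall>i\<in>{n..<l}. v 0 dvd (W i choose v 3)" "\<forall>a\<in>set As. sat_mod (v 0) W a" by blast
    define w where "w i = (if i < n + 4 then v i else W (i - 4))" for i
    have W2: "W i = v (i + 4)" if "1 \<le> i" "i < n" for i
    proof -
      have "i - 1 + 5 = i + 4" using that by simp
      then show ?thesis using W(2) that by (metis atLeastLessThan_iff)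
    qed
    have wr: "w (r i) = W i" for i
      using W(1) W2[of i] n by (cases "i = 0"; cases "i < n") (simp_all add: w_def r_def)
    have w0: "w 0 = v 0" "w 3 = v 3"
      using n by (simp_all add: w_def)
    have w4: "w (i + 4) = W i" if "1 \<le> i" for i
      using W2[OF that] by (simp add: w_def)
    have "w (i + 4) < w 3" if "i \<in> {1..<n}" for i
      using w4[of i] w0 W(2) that by (metis atLeastLessThan_iff)
    moreover have "w 0 dvd (w (i + 4) choose w 3)" if "i \<in> {n..<l}" for i
      using w4[of i] w0 W(3) that n by (metis atLeastLessThan_iff order_trans)
    moreover have "sat_mod (w 0) (\<lambda>i. w (r i)) a" if "a \<in> set As" for a
      using W(4) that w0 unfolding wr by simp
    ultimately have "?S w" by blast
    then show "\<exists>w. (\<forall>i<n + 4. w i = v i) \<and> ?S w"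
      by (intro exI[of _ w]) (simp add: w_def)
  qed
  ultimately have H: "dio True (\<lambda>v. ?H (v 0) (v (Suc 0)) (v (Suc (Suc (Suc 0)))) (\<lambda>i. v (Suc (Suc (Suc (Suc (Suc i)))))))"
    by (simp add: numeral_eq_Suc)
  have dio: "dio True (\<lambda>v. \<exists>U T B M. v 0 \<le> U \<and> T = U * U + 2 * U + C + 3 \<and> B + 1 = fact T * fact T \<and>
     M = (B choose v 0) \<and> ?H M B U (\<lambda>i. v (Suc i)))"
    by (rule dio_ex dio_conj H | rule dio_le dio_eq diof_var diof_add diof_const diof_mult diof_fact diof_choose)+
  have iff: "(\<exists>U T B M. N \<le> U \<and> T = U * U + 2 * U + C + 3 \<and> B + 1 = fact T * fact T \<and>
     M = (B choose N) \<and> ?H M B U e) \<longleftrightarrow> (\<forall>k<N. R e k)" for N e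
  proof -
    have "B + 1 = fact T * fact T \<longleftrightarrow> B = fact T * fact T - 1" for B T :: nat
      using mult_pos_pos[OF fact_gt_zero[of T, where 'a = nat] fact_gt_zero[of T, where 'a = nat]] by linarith
    then show ?thesis
      unfolding R using bounded_forall_iff[of As l C n N e] As l C n
      by (simp add: subset_iff)
  qed
  show "dio True (\<lambda>v. \<forall>k<v 0. R (\<lambda>i. v (Suc i)) k)"
    apply (rule back_subst[of "dio True", OF dio])
    apply (rule ext)
    subgoal for v by (rule iff[of "v 0" "\<lambda>i. v (Suc i)"])
    done
qed

section \<open>Inductively generated sets are exponential Diophantine\<close>

lemma dio_comp3:
  assumes "dio p (\<lambda>v. R (v 0) (v (Suc 0)) (v (Suc (Suc 0))))" "diof p f" "diof p g" "diof p h"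
  shows "dio p (\<lambda>v. R (f v) (g v) (h v))"
proof -
  have 1: "dio p (\<lambda>v. R (v 0) (v (Suc 0)) (h (\<lambda>i. v (Suc (Suc i)))))"
  proof (rule dio_let[where R = "\<lambda>v x. R (v 0) (v (Suc 0)) x"])
    show "dio p (\<lambda>v. R (v (Suc 0)) (v (Suc (Suc 0))) (v 0))"
      using dio_rename[OF assms(1), of "\<lambda>i. if i = 0 then Suc 0 else if i = Suc 0 then Suc (Suc 0) else 0"] by simp
    show "diof p (\<lambda>v. h (\<lambda>i. v (Suc (Suc i))))"
      using diof_shift[OF diof_shift[OF assms(4)]] by simp
  qed
  have 2: "dio p (\<lambda>v. R (v 0) (g (\<lambda>i. v (Suc i))) (h (\<lambda>i. v (Suc i))))"
  proof (rule dio_let[where R = "\<lambda>v x. R (v 0) x (h (\<lambda>i. v (Suc i)))"])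
    show "dio p (\<lambda>v. R (v (Suc 0)) (v 0) (h (\<lambda>i. v (Suc (Suc i)))))"
      using dio_rename[OF 1, of "\<lambda>i. if i = 0 then Suc 0 else if i = Suc 0 then 0 else i"] by simp
    show "diof p (\<lambda>v. g (\<lambda>i. v (Suc i)))"
      by (rule diof_shift[OF assms(3)])
  qed
  show ?thesis
    by (rule dio_let[where R = "\<lambda>v x. R x (g v) (h v)", OF 2 assms(2)])
qed

text \<open>Goedel's beta function. It codes a finite sequence by two numbers without exponentials
  and so may stand inside the bounded quantifier.\<close>

definition beta :: "nat \<Rightarrow> nat \<Rightarrow> nat \<Rightarrow> nat" where
  "beta S q i = S mod (Suc i * q + 1)"

lemma beta_exists:
  fixes s :: "nat \<Rightarrow> nat"
  shows "\<exists>S q. \<forall>i\<le>n. beta S q i = s i"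
proof -
  \<comment> \<open>\<open>M\<close> bounds both the index differences and the values. Its factorial
    makes the moduli pairwise coprime, since a common prime divides an index difference, hence
    \<open>q\<close>, hence 1, and makes each modulus exceed the value it carries.\<close>
  define M where "M = n + (\<Sum>i\<le>n. s i)"
  define q :: nat where "q = fact M"
  have s: "s i < Suc i * q + 1" if "i \<le> n" for i
  proof -
    have "s i \<le> M"
      using member_le_sum[of i "{..n}" s] that by (simp add: M_def)
    also have "M \<le> q" unfolding q_def by (rule fact_ge_self)
    also have "q \<le> Suc i * q" by simp
    finally show ?thesis by simp
  qed
  have coprime: "coprime (Suc i * q + 1) (Suc j * q + 1)" if "i < j" "j \<le> n" for i j
  proof (rule ccontr)
    assume "\<not> coprime (Suc i * q + 1) (Suc j * q + 1)"
    then obtain p where p: "prime p" "p dvd Suc i * q + 1" "p dvd Suc j * q + 1"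
      by (rule not_coprime_prime)
    have "p dvd Suc j * (Suc i * q + 1) - Suc i * (Suc j * q + 1)"
      using p by (intro dvd_diff_nat dvd_mult)
    also have "Suc j * (Suc i * q + 1) - Suc i * (Suc j * q + 1) = j - i"
      by (simp add: algebra_simps)
    finally have "p \<le> j - i" using that by (intro dvd_imp_le) auto
    then have "p \<le> M" using that by (simp add: M_def)
    then have "p dvd q" using p(1) by (simp add: q_def prime_dvd_fact_iff)
    then have "p dvd (Suc i * q + 1) - Suc i * q"
      using p(2) by (intro dvd_diff_nat dvd_mult)
    then show False using p(1) by simp
  qed
  have "\<forall>i\<in>{..n}. \<forall>j\<in>{..n}. i \<noteq> j \<longrightarrow> coprime (Suc i * q + 1) (Suc j * q + 1)"
    using coprime coprime_commute by (metis atMost_iff linorder_neqE_nat)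
  then obtain S where S: "\<forall>i\<in>{..n}. [S = s i] (mod (Suc i * q + 1))"
    using chinese_remainder_nat[of "{..n}" "\<lambda>i. Suc i * q + 1" s] by blast
  have "beta S q i = s i" if "i \<le> n" for i
    using S s[OF that] that by (simp add: beta_def cong_def)
  then show ?thesis by blast
qed

text \<open>With two premises per rule, checking a step needs a fixed number of existential
  quantifiers over earlier positions.\<close>

inductive der :: "(nat \<Rightarrow> bool) \<Rightarrow> (nat \<Rightarrow> nat \<Rightarrow> nat \<Rightarrow> bool) \<Rightarrow> nat \<Rightarrow> bool" for A R where
  axiom: "A s \<Longrightarrow> der A R s"
| rule: "der A R a \<Longrightarrow> der A R b \<Longrightarrow> R a b s \<Longrightarrow> der A R s"

lemma der_imp_sequence:
  "der A R s \<Longrightarrow> \<exists>(n::nat) t. t n = s \<and> (\<forall>i\<le>n. A (t i) \<or> (\<exists>j<i. \<exists>k<i. R (t j) (t k) (t i)))"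
proof (induction rule: der.induct)
  case (axiom s)
  then have "A s" .
  then show ?case
    by - (rule exI[of _ "0::nat"], rule exI[of _ "\<lambda>_. s"], simp)
next
  case (rule a b s)
  obtain n :: nat and t where t: "t n = a" "\<And>i. i \<le> n \<Longrightarrow> A (t i) \<or> (\<exists>j<i. \<exists>k<i. R (t j) (t k) (t i))"
    using rule.IH(1) by blast
  obtain m :: nat and u where u: "u m = b" "\<And>i. i \<le> m \<Longrightarrow> A (u i) \<or> (\<exists>j<i. \<exists>k<i. R (u j) (u k) (u i))"
    using rule.IH(2) by blast
  \<comment> \<open>Positions up to \<open>n\<close> hold the first derivation, those from
    \<open>n + 1\<close> to \<open>n + m + 1\<close> the second, and \<open>n + m + 2\<close> the
    conclusion.\<close>
  define w where "w i = (if i \<le> n then t i else if i \<le> n + m + 1 then u (i - Suc n) else s)" for i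
  have "A (w i) \<or> (\<exists>j<i. \<exists>k<i. R (w j) (w k) (w i))" if i: "i \<le> n + m + 2" for i
  proof -
    consider "i \<le> n" | "n < i" "i \<le> n + m + 1" | "i = n + m + 2"
      using i by linarith
    then show ?thesis
    proof cases
      case 1
      then show ?thesis using t(2)[OF 1] by (fastforce simp: w_def)
    next
      case 2
      define i' where "i' = i - Suc n"
      have i': "i' \<le> m" "i = Suc n + i'" using 2 by (auto simp: i'_def)
      from u(2)[OF i'(1)] show ?thesis
      proof
        assume "A (u i')"
        then show ?thesis using i' by (simp add: w_def)
      next
        assume "\<exists>j<i'. \<exists>k<i'. R (u j) (u k) (u i')"
        then obtain j k where "j < i'" "k < i'" "R (u j) (u k) (u i')" by blast
        then have "Suc n + j < i" "Suc n + k < i" "R (w (Suc n + j)) (w (Suc n + k)) (w i)"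
          using i' by (simp_all add: w_def)
        then show ?thesis by blast
      qed
    next
      case 3
      have "R (w n) (w (n + m + 1)) (w i)"
        using 3 rule.hyps(3) t(1) u(1) by (simp add: w_def)
      moreover have "n < i" "n + m + 1 < i" using 3 by simp_all
      ultimately show ?thesis by blast
    qed
  qed
  moreover have "w (n + m + 2) = s" by (simp add: w_def)
  ultimately show ?case by blast
qed

text \<open>The only universal quantifier left is the one over the positions \<open>i\<close>, in
  the shape required by \<open>dio_bounded_forall\<close>.\<close>

lemma der_iff_beta:
  "der A R s \<longleftrightarrow> (\<exists>n S q. beta S q n = s \<and> (\<forall>i<Suc n. A (beta S q i) \<or>
     (\<exists>j k. j < i \<and> k < i \<and> R (beta S q j) (beta S q k) (beta S q i))))"
proof
  assume "der A R s"
  then obtain n :: nat and t where t: "t n = s" "\<And>i. i \<le> n \<Longrightarrow> A (t i) \<or> (\<exists>j<i. \<exists>k<i. R (t j) (t k) (t i))"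
    using der_imp_sequence by blast
  obtain S q where b: "\<And>i. i \<le> n \<Longrightarrow> beta S q i = t i"
    using beta_exists by blast
  have "A (beta S q i) \<or> (\<exists>j k. j < i \<and> k < i \<and> R (beta S q j) (beta S q k) (beta S q i))"
    if "i < Suc n" for i
    using t(2)[of i] b that by (metis less_Suc_eq_le less_imp_le_nat order_trans)
  then show "\<exists>n S q. beta S q n = s \<and> (\<forall>i<Suc n. A (beta S q i) \<or>
     (\<exists>j k. j < i \<and> k < i \<and> R (beta S q j) (beta S q k) (beta S q i)))"
    using t(1) b[of n] by blast
next
  assume "\<exists>n S q. beta S q n = s \<and> (\<forall>i<Suc n. A (beta S q i) \<or>
     (\<exists>j k. j < i \<and> k < i \<and> R (beta S q j) (beta S q k) (beta S q i)))"
  then obtain n S q where s: "beta S q n = s"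
    and step: "\<And>i. i < Suc n \<Longrightarrow> A (beta S q i) \<or>
     (\<exists>j k. j < i \<and> k < i \<and> R (beta S q j) (beta S q k) (beta S q i))" by blast
  have "i \<le> n \<Longrightarrow> der A R (beta S q i)" for i
  proof (induction i rule: less_induct)
    case (less i)
    from less.prems have "i < Suc n" by simp
    then consider "A (beta S q i)"
      | j k where "j < i" "k < i" "R (beta S q j) (beta S q k) (beta S q i)"
      using step by blast
    then show ?case
    proof cases
      case 1
      then show ?thesis by (rule der.axiom)
    next
      case 2
      then have "der A R (beta S q j)" "der A R (beta S q k)"
        using less by simp_all
      then show ?thesis using 2(3) by (rule der.rule)
    qed
  qed
  then show "der A R s" using s by blast
qed

lemma diof_beta:
  assumes "diof p f" "diof p g" "diof p h"
  shows "diof p (\<lambda>v. beta (f v) (g v) (h v))"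
  unfolding beta_def using assms by (intro diof_mod diof_add diof_mult diof_Suc diof_const)

theorem dio_der:
  assumes A: "dio False (\<lambda>v. A (v 0))"
    and R: "dio False (\<lambda>v. R (v 0) (v (Suc 0)) (v (Suc (Suc 0))))"
    and f: "diof True f"
  shows "dio True (\<lambda>v. der A R (f v))"
proof (rule dio_comp1[OF _ f])
  note A' = dio_comp1[OF A] and R' = dio_comp3[OF R]
  show "dio True (\<lambda>v. der A R (v 0))"
    unfolding der_iff_beta
    by (intro dio_ex dio_conj dio_bounded_forall dio_disj dio_eq dio_less A' R'
        diof_beta diof_var diof_Suc)
qed

section \<open>Evaluation of recursive functions as an inductively generated set\<close>

text \<open>A polynomial injection, so that no division is needed inside the bounded quantifier.\<close>

definition pr :: "nat \<Rightarrow> nat \<Rightarrow> nat" where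
  "pr a b = (a + b) * (a + b) + a"

text \<open>\<open>pr a b\<close> lies between the consecutive squares of \<open>a + b\<close> and
  \<open>a + b + 1\<close>; it therefore determines \<open>a + b\<close> and then
  \<open>a\<close>.\<close>

lemma pr_eq_iff [simp]: "pr a b = pr c d \<longleftrightarrow> a = c \<and> b = d"
proof
  have less: "pr a b < pr c d" if "a + b < c + d" for a b c d
  proof -
    have "pr a b < Suc (a + b) * Suc (a + b)" by (simp add: pr_def)
    also have "\<dots> \<le> (c + d) * (c + d)" using that by (intro mult_mono) auto
    also have "\<dots> \<le> pr c d" by (simp add: pr_def)
    finally show ?thesis .
  qed
  assume eq: "pr a b = pr c d"
  then have "a + b = c + d"
    using less[of a b c d] less[of c d a b] by (metis less_irrefl linorder_neqE_nat)
  with eq show "a = c \<and> b = d" by (simp add: pr_def)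
qed simp

lemma diof_pr: "diof p f \<Longrightarrow> diof p g \<Longrightarrow> diof p (\<lambda>v. pr (f v) (g v))"
  unfolding pr_def by (intro diof_add diof_mult)

primrec clist :: "nat list \<Rightarrow> nat" where
  "clist [] = 0"
| "clist (x # xs) = Suc (pr x (clist xs))"

primrec code :: "recf \<Rightarrow> nat" where
  "code Zf = pr 0 0"
| "code Sf = pr 1 0"
| "code (Idf i) = pr 2 i"
| "code (Cn f gs) = pr 3 (pr (code f) (clist (map code gs)))"
| "code (Pr f g) = pr 4 (pr (code f) (code g))"
| "code (Mn f) = pr 5 (code f)"

text \<open>Four kinds of facts are derived: \<open>ev F X y\<close> (the function \<open>F\<close> maps the list \<open>X\<close> to \<open>y\<close>),
  \<open>ls G X Y\<close> (the list of functions \<open>G\<close> maps \<open>X\<close> to the list \<open>Y\<close>), \<open>nt i X y\<close> (entry \<open>i\<close> of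
  \<open>X\<close> is \<open>y\<close>) and \<open>mn F n X\<close> (\<open>F\<close> is positive on \<open>m # X\<close> for all \<open>m < n\<close>).\<close>

definition ev :: "nat \<Rightarrow> nat \<Rightarrow> nat \<Rightarrow> nat" where "ev a b c = pr (pr 0 a) (pr b c)"
definition ls :: "nat \<Rightarrow> nat \<Rightarrow> nat \<Rightarrow> nat" where "ls a b c = pr (pr 1 a) (pr b c)"
definition nt :: "nat \<Rightarrow> nat \<Rightarrow> nat \<Rightarrow> nat" where "nt a b c = pr (pr 2 a) (pr b c)"
definition mn :: "nat \<Rightarrow> nat \<Rightarrow> nat \<Rightarrow> nat" where "mn a b c = pr (pr 3 a) (pr b c)"

lemmas fact_defs = ev_def ls_def nt_def mn_def

inductive eval_axiom :: "nat \<Rightarrow> bool" where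
  "eval_axiom (ev (pr 0 0) a 0)"
| "eval_axiom (ev (pr 1 0) (Suc (pr x a)) (Suc x))"
| "eval_axiom (nt 0 (Suc (pr x a)) x)"
| "eval_axiom (ls 0 a 0)"
| "eval_axiom (mn f 0 a)"

text \<open>Rules with one premise leave \<open>b\<close> free and are applied with that premise
  given twice. All components range over arbitrary numbers, so membership is a plain disjunction of
  polynomial equations.\<close>

inductive eval_rule :: "nat \<Rightarrow> nat \<Rightarrow> nat \<Rightarrow> bool" where
  "eval_rule (nt i a y) b (nt (Suc i) (Suc (pr x a)) y)"
| "eval_rule (nt i a y) b (ev (pr 2 i) a y)"
| "eval_rule (ev f a y) (ls g a ys) (ls (Suc (pr f g)) a (Suc (pr y ys)))"
| "eval_rule (ls g a ys) (ev f ys z) (ev (pr 3 (pr f g)) a z)"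
| "eval_rule (ev f a y) b (ev (pr 4 (pr f g)) (Suc (pr 0 a)) y)"
| "eval_rule (ev (pr 4 (pr f g)) (Suc (pr n a)) y) (ev g (Suc (pr n (Suc (pr y a)))) z)
     (ev (pr 4 (pr f g)) (Suc (pr (Suc n) a)) z)"
| "eval_rule (mn f n a) (ev f (Suc (pr n a)) (Suc y)) (mn f (Suc n) a)"
| "eval_rule (mn f n a) (ev f (Suc (pr n a)) 0) (ev (pr 5 f) a n)"

abbreviation derivable :: "nat \<Rightarrow> bool" where
  "derivable \<equiv> der eval_axiom eval_rule"

lemma dio_derivable: "diof True f \<Longrightarrow> dio True (\<lambda>v. derivable (f v))"
proof (rule dio_der)
  show "dio False (\<lambda>v. eval_axiom (v 0))"
    unfolding eval_axiom.simps fact_defs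
    by (intro dio_disj dio_ex dio_conj dio_eq diof_pr diof_Suc diof_var diof_const)
  show "dio False (\<lambda>v. eval_rule (v 0) (v (Suc 0)) (v (Suc (Suc 0))))"
    unfolding eval_rule.simps fact_defs
    by (intro dio_disj dio_ex dio_conj dio_eq diof_pr diof_Suc diof_var diof_const)
qed

text \<open>Rules also produce facts about numbers that code nothing, and about those nothing is
  claimed. The result list of an \<open>ls\<close> fact is the exception: that it is a code has to
  be concluded, because in a composition it is an intermediate value.\<close>

definition sound :: "nat \<Rightarrow> bool" where
  "sound s \<longleftrightarrow>
    (\<forall>f xs y. s = ev (code f) (clist xs) y \<longrightarrow> rec_eval f xs y) \<and>
    (\<forall>gs xs Y. s = ls (clist (map code gs)) (clist xs) Y \<longrightarrow>
       (\<exists>ys. Y = clist ys \<and> length ys = length gs \<and> (\<forall>i<length gs. rec_eval (gs ! i) xs (ys ! i)))) \<and>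
    (\<forall>i xs y. s = nt i (clist xs) y \<longrightarrow> i < length xs \<and> xs ! i = y) \<and>
    (\<forall>f n xs. s = mn (code f) n (clist xs) \<longrightarrow> (\<forall>m<n. \<exists>y>0. rec_eval f (m # xs) y))"

lemma clist_eq_Suc: "Suc (pr x c) = clist xs \<longleftrightarrow> (\<exists>xs'. xs = x # xs' \<and> c = clist xs')"
  by (cases xs) auto

lemma clist_eq_0: "0 = clist xs \<longleftrightarrow> xs = []"
  by (cases xs) auto

lemma code_eq:
  "pr 0 0 = code f \<longleftrightarrow> f = Zf"
  "pr (Suc 0) 0 = code f \<longleftrightarrow> f = Sf"
  "pr 2 i = code f \<longleftrightarrow> f = Idf i"
  "pr 3 (pr a b) = code f \<longleftrightarrow> (\<exists>g hs. f = Cn g hs \<and> a = code g \<and> b = clist (map code hs))"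
  "pr 4 (pr a b) = code f \<longleftrightarrow> (\<exists>g h. f = Pr g h \<and> a = code g \<and> b = code h)"
  "pr 5 a = code f \<longleftrightarrow> (\<exists>g. f = Mn g \<and> a = code g)"
  by (cases f; auto)+

lemma soundD:
  assumes "sound s"
  shows "s = ev (code f) (clist xs) y \<Longrightarrow> rec_eval f xs y"
    and "s = ls (clist (map code gs)) (clist xs) d \<Longrightarrow>
       \<exists>ys. d = clist ys \<and> length ys = length gs \<and> (\<forall>i<length gs. rec_eval (gs ! i) xs (ys ! i))"
    and "s = mn (code f) n (clist xs) \<Longrightarrow> \<forall>m<n. \<exists>y>0. rec_eval f (m # xs) y"
  using assms unfolding sound_def by simp_all

lemma sound_axiom: "eval_axiom s \<Longrightarrow> sound s"
  by (erule eval_axiom.cases; simp add: sound_def fact_defs clist_eq_Suc clist_eq_0 code_eq)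
    (auto intro: rec_eval.intros)

lemma sound_rule:
  assumes "eval_rule a b s" "sound a" "sound b"
  shows "sound s"
  using assms(1)
proof (rule eval_rule.cases)
  fix i x X y assume "a = nt i X y" "s = nt (Suc i) (Suc (pr x X)) y"
  then show ?thesis using assms(2) by (auto simp: sound_def fact_defs clist_eq_Suc)
next
  fix i X y assume "a = nt i X y" "s = ev (pr 2 i) X y"
  then show ?thesis using assms(2) by (auto simp: sound_def fact_defs code_eq intro: rec_eval.proj)
next
  fix F X y G Y assume *: "a = ev F X y" "b = ls G X Y" "s = ls (Suc (pr F G)) X (Suc (pr y Y))"
  have "\<exists>ys. Suc (pr y Y) = clist ys \<and> length ys = length gs \<and> (\<forall>i<length gs. rec_eval (gs ! i) xs (ys ! i))"
    if Gs: "Suc (pr F G) = clist (map code gs)" and Xs: "X = clist xs" for gs xs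
  proof -
    obtain g gs' where gs: "gs = g # gs'" "F = code g" "G = clist (map code gs')"
      using Gs by (auto simp: clist_eq_Suc map_eq_Cons_conv)
    have "rec_eval g xs y"
      using assms(2) * gs Xs by (auto simp: sound_def fact_defs)
    moreover have "b = ls (clist (map code gs')) (clist xs) Y"
      using * gs Xs by simp
    then obtain ys where "Y = clist ys" "length ys = length gs'" "\<forall>i<length gs'. rec_eval (gs' ! i) xs (ys ! i)"
      using soundD(2)[OF assms(3)] by blast
    ultimately show ?thesis
      using gs(1) by (intro exI[of _ "y # ys"]) (auto simp: less_Suc_eq_0_disj)
  qed
  then show ?thesis using * by (simp add: sound_def fact_defs)
next
  fix F G X Y z assume *: "a = ls G X Y" "b = ev F Y z" "s = ev (pr 3 (pr F G)) X z"
  have "rec_eval f xs z" if f: "pr 3 (pr F G) = code f" and X: "X = clist xs" for f xs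
  proof -
    obtain g hs where g: "f = Cn g hs" "F = code g" "G = clist (map code hs)"
      using f by (auto simp: code_eq)
    have "a = ls (clist (map code hs)) (clist xs) Y"
      using * g X by simp
    then obtain ys where ys: "Y = clist ys" "length ys = length hs" "\<forall>i<length hs. rec_eval (hs ! i) xs (ys ! i)"
      using soundD(2)[OF assms(2)] by blast
    moreover have "b = ev (code g) (clist ys) z"
      using * g ys by simp
    then have "rec_eval g ys z"
      by (rule soundD(1)[OF assms(3)])
    ultimately show ?thesis unfolding g by (blast intro: rec_eval.comp)
  qed
  then show ?thesis using * by (simp add: sound_def fact_defs)
next
  fix F G X y assume "a = ev F X y" "s = ev (pr 4 (pr F G)) (Suc (pr 0 X)) y"
  then show ?thesis
    using assms(2) by (auto simp: sound_def fact_defs code_eq clist_eq_Suc intro: rec_eval.prim0)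
next
  fix F G n X y z assume *: "a = ev (pr 4 (pr F G)) (Suc (pr n X)) y"
    "b = ev G (Suc (pr n (Suc (pr y X)))) z" "s = ev (pr 4 (pr F G)) (Suc (pr (Suc n) X)) z"
  have "rec_eval f xs z" if f: "pr 4 (pr F G) = code f" and X: "Suc (pr (Suc n) X) = clist xs" for f xs
  proof -
    obtain g h where g: "f = Pr g h" "F = code g" "G = code h"
      using f by (auto simp: code_eq)
    obtain xs' where xs: "xs = Suc n # xs'" "X = clist xs'"
      using X by (auto simp: clist_eq_Suc)
    have ab: "a = ev (code (Pr g h)) (clist (n # xs')) y" "b = ev (code h) (clist (n # y # xs')) z"
      using * g xs by simp_all
    show ?thesis
      unfolding g xs using soundD(1)[OF assms(2) ab(1)] soundD(1)[OF assms(3) ab(2)] by (rule rec_eval.primS)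
  qed
  then show ?thesis using * by (simp add: sound_def fact_defs)
next
  fix F n X y assume *: "a = mn F n X" "b = ev F (Suc (pr n X)) (Suc y)" "s = mn F (Suc n) X"
  have "\<exists>y>0. rec_eval f (m # xs) y" if f: "F = code f" and X: "X = clist xs" and m: "m < Suc n" for f xs m
  proof -
    have ab: "a = mn (code f) n (clist xs)" "b = ev (code f) (clist (n # xs)) (Suc y)"
      using * f X by simp_all
    note soundD(3)[OF assms(2) ab(1)] soundD(1)[OF assms(3) ab(2)]
    then show ?thesis using m by (cases "m = n") auto
  qed
  then show ?thesis using * by (simp add: sound_def fact_defs)
next
  fix F n X assume *: "a = mn F n X" "b = ev F (Suc (pr n X)) 0" "s = ev (pr 5 F) X n"
  have "rec_eval f xs n" if f: "pr 5 F = code f" and X: "X = clist xs" for f xs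
  proof -
    obtain g where g: "f = Mn g" "F = code g"
      using f by (auto simp: code_eq)
    have ab: "a = mn (code g) n (clist xs)" "b = ev (code g) (clist (n # xs)) 0"
      using * g X by simp_all
    note soundD(3)[OF assms(2) ab(1)] soundD(1)[OF assms(3) ab(2)]
    then show ?thesis unfolding g by (blast intro: rec_eval.mini)
  qed
  then show ?thesis using * by (simp add: sound_def fact_defs)
qed

lemma derivable_imp_sound: "derivable s \<Longrightarrow> sound s"
  by (induction rule: der.induct) (auto intro: sound_axiom sound_rule)

section \<open>Completeness: every evaluation has a derivation\<close>

lemma derivable_nt: "i < length xs \<Longrightarrow> derivable (nt i (clist xs) (xs ! i))"
proof (induction xs arbitrary: i)
  case (Cons x xs)
  show ?case
  proof (cases i)
    case 0
    then show ?thesis by (auto intro!: der.axiom eval_axiom.intros)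
  next
    case (Suc j)
    then have "derivable (nt j (clist xs) (xs ! j))" using Cons by simp
    from this this have "derivable (nt (Suc j) (Suc (pr x (clist xs))) (xs ! j))"
      by (rule der.rule) (rule eval_rule.intros)
    then show ?thesis using Suc by simp
  qed
qed simp

lemma derivable_ls:
  assumes "length ys = length gs" "\<And>i. i < length gs \<Longrightarrow> derivable (ev (code (gs ! i)) c (ys ! i))"
  shows "derivable (ls (clist (map code gs)) c (clist ys))"
  using assms
proof (induction gs ys rule: list_induct2')
  case 1
  then show ?case by (auto intro!: der.axiom eval_axiom.intros)
next
  case (4 g gs y ys)
  have "derivable (ev (code g) c y)" using 4(3)[of 0] by simp
  moreover have "derivable (ls (clist (map code gs)) c (clist ys))"
    using 4(2) 4(3)[of "Suc _"] by (intro 4(1)) auto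
  ultimately show ?case
    unfolding list.map clist.simps by (rule der.rule) (rule eval_rule.intros)
qed auto

lemma rec_eval_imp_derivable: "rec_eval f xs y \<Longrightarrow> derivable (ev (code f) (clist xs) y)"
proof (induction rule: rec_eval.induct)
  case (zero xs)
  show ?case unfolding code.simps by (intro der.axiom eval_axiom.intros)
next
  case (succ x xs)
  show ?case unfolding code.simps clist.simps by (intro der.axiom eval_axiom.intros)
next
  case (proj i xs)
  show ?case
    unfolding code.simps
    by (rule der.rule[OF derivable_nt[OF proj] derivable_nt[OF proj] eval_rule.intros(2)])
next
  case (comp ys gs xs f z)
  have "derivable (ls (clist (map code gs)) (clist xs) (clist ys))"
    using comp by (intro derivable_ls) auto
  then show ?case
    using comp(4) unfolding code.simps by (rule der.rule) (rule eval_rule.intros)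
next
  case (prim0 f xs y g)
  show ?case
    unfolding code.simps clist.simps
    by (rule der.rule[OF prim0(2) prim0(2) eval_rule.intros(5)])
next
  case (primS f g n xs y z)
  show ?case
    using primS(3,4) unfolding code.simps clist.simps
    by (rule der.rule) (rule eval_rule.intros)
next
  case (mini f n xs)
  have "m \<le> n \<Longrightarrow> derivable (mn (code f) m (clist xs))" for m
  proof (induction m)
    case 0
    then show ?case by (auto intro!: der.axiom eval_axiom.intros)
  next
    case (Suc m)
    then have "m < n" by simp
    then obtain y where "0 < y" "derivable (ev (code f) (clist (m # xs)) y)"
      using mini.IH(2) by blast
    \<comment> \<open>Positivity is written as a successor to match the rule for
      \<open>mn\<close>.\<close>
    then have "derivable (ev (code f) (Suc (pr m (clist xs))) (Suc (y - 1)))" by simp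
    with Suc.IH[OF less_imp_le[OF \<open>m < n\<close>]] show ?case
      by (rule der.rule) (rule eval_rule.intros)
  qed
  then have "derivable (mn (code f) n (clist xs))" by simp
  moreover have "derivable (ev (code f) (clist (n # xs)) 0)" using mini by simp
  ultimately show ?case
    unfolding code.simps clist.simps by (rule der.rule) (rule eval_rule.intros)
qed

lemma derivable_iff_rec_eval: "derivable (ev (code f) (clist xs) y) \<longleftrightarrow> rec_eval f xs y"
  using soundD(1)[OF derivable_imp_sound] rec_eval_imp_derivable by blast

definition diagonal :: "nat \<Rightarrow> bool" where
  "diagonal e \<longleftrightarrow> derivable (ev e (clist [e]) 1)"

lemma diagonal_code: "diagonal (code f) \<longleftrightarrow> rec_eval f [code f] 1"
  unfolding diagonal_def by (rule derivable_iff_rec_eval)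

lemma dio_diagonal: "dio True (\<lambda>v. diagonal (v 0))"
  unfolding diagonal_def ev_def clist.simps
  by (intro dio_derivable diof_pr diof_Suc diof_var diof_const)

section \<open>Exponential polynomials as entries of upper triangular products\<close>

fun word_mat :: "nat \<Rightarrow> int mat \<Rightarrow> int mat \<Rightarrow> nat list \<Rightarrow> int mat" where
  "word_mat k A B [] = 1\<^sub>m k"
| "word_mat k A B [a] = A ^\<^sub>m a"
| "word_mat k A B (a # b # as) = A ^\<^sub>m a * (B * word_mat k A B (b # as))"

lemma word_mat_carrier [simp]:
  "A \<in> carrier_mat k k \<Longrightarrow> B \<in> carrier_mat k k \<Longrightarrow> word_mat k A B as \<in> carrier_mat k k"
  by (induction k A B as rule: word_mat.induct) (auto intro!: mult_carrier_mat pow_carrier_mat)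

section \<open>Block triangular matrices\<close>

definition tri :: "nat \<Rightarrow> nat \<Rightarrow> int mat \<Rightarrow> int mat \<Rightarrow> int mat \<Rightarrow> int mat" where
  "tri k l A B D = four_block_mat A B (0\<^sub>m l k) D"

lemma tri_carrier [simp]:
  "A \<in> carrier_mat k k \<Longrightarrow> D \<in> carrier_mat l l \<Longrightarrow> tri k l A B D \<in> carrier_mat (k + l) (k + l)"
  unfolding tri_def by simp

lemma tri_upper_triangular:
  "A \<in> carrier_mat k k \<Longrightarrow> D \<in> carrier_mat l l \<Longrightarrow> upper_triangular A \<Longrightarrow> upper_triangular D \<Longrightarrow>
    upper_triangular (tri k l A B D)"
  unfolding tri_def by (rule upper_triangular_four_block)

lemma tri_mult:
  assumes "A \<in> carrier_mat k k" "B \<in> carrier_mat k l" "D \<in> carrier_mat l l"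
    "A' \<in> carrier_mat k k" "B' \<in> carrier_mat k l" "D' \<in> carrier_mat l l"
  shows "tri k l A B D * tri k l A' B' D' = tri k l (A * A') (A * B' + B * D') (D * D')"
proof -
  have "A * A' + B * 0\<^sub>m l k = A * A'" "0\<^sub>m l k * A' + D * 0\<^sub>m l k = 0\<^sub>m l k" "0\<^sub>m l k * B' + D * D' = D * D'"
    using assms by auto
  then show ?thesis
    unfolding tri_def
    by (subst mult_four_block_mat[OF assms(1,2) zero_carrier_mat assms(3) assms(4,5) zero_carrier_mat assms(6)])
      simp
qed

lemma tri_mult_diag:
  assumes "A \<in> carrier_mat k k" "D \<in> carrier_mat l l" "A' \<in> carrier_mat k k" "D' \<in> carrier_mat l l"
  shows "tri k l A (0\<^sub>m k l) D * tri k l A' (0\<^sub>m k l) D' = tri k l (A * A') (0\<^sub>m k l) (D * D')"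
  using tri_mult[OF assms(1) zero_carrier_mat assms(2,3) zero_carrier_mat assms(4)]
    right_mult_zero_mat[OF assms(1), of l] left_mult_zero_mat[OF assms(4), of k]
  by simp

lemma tri_pow:
  "A \<in> carrier_mat k k \<Longrightarrow> D \<in> carrier_mat l l \<Longrightarrow>
    tri k l A (0\<^sub>m k l) D ^\<^sub>m n = tri k l (A ^\<^sub>m n) (0\<^sub>m k l) (D ^\<^sub>m n)"
  unfolding tri_def by (rule pow_four_block_mat)

lemma tri_index:
  assumes "A \<in> carrier_mat k k" "D \<in> carrier_mat l l"
  shows "i < k \<Longrightarrow> j < k \<Longrightarrow> tri k l A B D $$ (i, j) = A $$ (i, j)"
    and "i < k \<Longrightarrow> j < l \<Longrightarrow> tri k l A B D $$ (i, k + j) = B $$ (i, j)"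
    and "i < l \<Longrightarrow> j < k \<Longrightarrow> tri k l A B D $$ (k + i, j) = 0"
    and "i < l \<Longrightarrow> j < l \<Longrightarrow> tri k l A B D $$ (k + i, k + j) = D $$ (i, j)"
  using assms by (auto simp: tri_def)

lemma tri_eq_iff:
  assumes "A \<in> carrier_mat k k" "D \<in> carrier_mat l l" "A' \<in> carrier_mat k k" "D' \<in> carrier_mat l l"
    "B \<in> carrier_mat k l"
  shows "tri k l A B D = tri k l A' B D' \<longleftrightarrow> A = A' \<and> D = D'"
proof
  assume eq: "tri k l A B D = tri k l A' B D'"
  have "A $$ (i, j) = A' $$ (i, j)" if "i < k" "j < k" for i j
    using that eq tri_index(1) assms by metis
  moreover have "D $$ (i, j) = D' $$ (i, j)" if "i < l" "j < l" for i j
    using that eq tri_index(4) assms by metis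
  ultimately show "A = A' \<and> D = D'"
    using assms by (intro conjI eq_matI) auto
qed simp

text \<open>Only the existence of the off-diagonal block \<open>Q\<close> is recorded: in the
  application the upper left block of the second matrix is zero and annihilates it.\<close>

lemma tri_word_mat:
  assumes A: "A \<in> carrier_mat k k" "A' \<in> carrier_mat l l"
    and B: "B \<in> carrier_mat k k" "E \<in> carrier_mat k l" "B' \<in> carrier_mat l l"
  shows "\<exists>Q\<in>carrier_mat k l. word_mat (k + l) (tri k l A (0\<^sub>m k l) A') (tri k l B E B') as =
      tri k l (word_mat k A B as) Q (word_mat l A' B' as)"
proof (induction as rule: induct_list012)
  case 1
  have "1\<^sub>m (k + l) = tri k l (1\<^sub>m k) (0\<^sub>m k l) (1\<^sub>m l)"
    unfolding tri_def by simp
  then show ?case by (auto intro!: bexI[of _ "0\<^sub>m k l"])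
next
  case (2 a)
  show ?case using A by (auto simp: tri_pow intro!: bexI[of _ "0\<^sub>m k l"])
next
  case (3 a b as)
  obtain Q where Q: "Q \<in> carrier_mat k l" "word_mat (k + l) (tri k l A (0\<^sub>m k l) A') (tri k l B E B') (b # as) =
      tri k l (word_mat k A B (b # as)) Q (word_mat l A' B' (b # as))"
    using 3 by blast
  let ?M = "word_mat k A B (b # as)" and ?M' = "word_mat l A' B' (b # as)"
  have M: "?M \<in> carrier_mat k k" "?M' \<in> carrier_mat l l" using A B by simp_all
  have c: "B * ?M \<in> carrier_mat k k" "B * Q + E * ?M' \<in> carrier_mat k l" "B' * ?M' \<in> carrier_mat l l"
    using B M Q(1) by auto
  have p: "A ^\<^sub>m a \<in> carrier_mat k k" "A' ^\<^sub>m a \<in> carrier_mat l l" using A by simp_all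
  have "word_mat (k + l) (tri k l A (0\<^sub>m k l) A') (tri k l B E B') (a # b # as) =
      tri k l (A ^\<^sub>m a * (B * ?M)) (A ^\<^sub>m a * (B * Q + E * ?M') + 0\<^sub>m k l * (B' * ?M')) (A' ^\<^sub>m a * (B' * ?M'))"
    unfolding word_mat.simps Q(2) tri_pow[OF A] tri_mult[OF B M(1) Q(1) M(2)]
    by (rule tri_mult) (use p c in auto)
  then show ?case
    unfolding word_mat.simps
    by (rule bexI) (intro add_carrier_mat mult_carrier_mat[OF zero_carrier_mat c(3)])
qed

lemma tri_word_mat_diag:
  assumes A: "A \<in> carrier_mat k k" "A' \<in> carrier_mat l l"
    and B: "B \<in> carrier_mat k k" "B' \<in> carrier_mat l l"
  shows "word_mat (k + l) (tri k l A (0\<^sub>m k l) A') (tri k l B (0\<^sub>m k l) B') as =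
      tri k l (word_mat k A B as) (0\<^sub>m k l) (word_mat l A' B' as)"
proof (induction as rule: induct_list012)
  case 1
  show ?case unfolding tri_def by simp
next
  case (2 a)
  show ?case using A by (simp add: tri_pow)
next
  case (3 a b as)
  let ?M = "word_mat k A B (b # as)" and ?M' = "word_mat l A' B' (b # as)"
  have M: "?M \<in> carrier_mat k k" "?M' \<in> carrier_mat l l" using A B by simp_all
  have c: "B * ?M \<in> carrier_mat k k" "B' * ?M' \<in> carrier_mat l l"
    "A ^\<^sub>m a \<in> carrier_mat k k" "A' ^\<^sub>m a \<in> carrier_mat l l"
    using A B M by auto
  have "tri k l B (0\<^sub>m k l) B' * tri k l ?M (0\<^sub>m k l) ?M' = tri k l (B * ?M) (0\<^sub>m k l) (B' * ?M')"
    using B M by (rule tri_mult_diag)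
  moreover have "tri k l (A ^\<^sub>m a) (0\<^sub>m k l) (A' ^\<^sub>m a) * tri k l (B * ?M) (0\<^sub>m k l) (B' * ?M') =
      tri k l (A ^\<^sub>m a * (B * ?M)) (0\<^sub>m k l) (A' ^\<^sub>m a * (B' * ?M'))"
    using c(3,4,1,2) by (rule tri_mult_diag)
  ultimately show ?case
    unfolding word_mat.simps 3(2) tri_pow[OF A] by simp
qed

text \<open>The corner entry is chosen so that blocks can be chained, by joining the last index of
  one to the first index of the next.\<close>

definition gadget :: "(nat \<Rightarrow> int) \<Rightarrow> bool" where
  "gadget f \<longleftrightarrow> (\<exists>k>0. \<exists>A\<in>carrier_mat k k. upper_triangular A \<and> (\<forall>a. (A ^\<^sub>m a) $$ (0, k - 1) = f a))"

lemma gadget_power: "gadget (\<lambda>a. q ^ a)"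
proof -
  define A where "A = mat 1 1 (\<lambda>_. q)"
  have "A ^\<^sub>m a = mat 1 1 (\<lambda>_. q ^ a)" for a
    by (induction a) (auto simp: A_def scalar_prod_def intro!: eq_matI)
  then show ?thesis
    unfolding gadget_def by (intro exI[of _ 1] conjI bexI[of _ A]) (auto simp: A_def)
qed

lemma gadget_one: "gadget (\<lambda>_. 1)"
  using gadget_power[of 1] by simp

lemma gadget_id: "gadget (\<lambda>a. int a)"
proof -
  define A :: "int mat" where "A = mat 2 2 (\<lambda>(i, j). if i \<le> j then 1 else 0)"
  have "A ^\<^sub>m a = mat 2 2 (\<lambda>(i, j). if i = j then 1 else if i < j then int a else 0)" for a
  proof (induction a)
    case 0
    show ?case by (auto simp: A_def)
  next
    case (Suc a)
    show ?case
      unfolding pow_mat.simps Suc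
      by (rule eq_matI) (auto simp: A_def scalar_prod_def numeral_2_eq_2 less_Suc_eq)
  qed
  then show ?thesis
    unfolding gadget_def by (intro exI[of _ 2] conjI bexI[of _ A]) (auto simp: A_def)
qed

text \<open>The top row of \<open>A ^\<^sub>m a\<close> is \<open>(1, a, a * a)\<close>; the last
  column of \<open>A\<close> realizes the step \<open>1 + 2 * a + a * a\<close> to the next square.
  It serves equations in which a variable is multiplied by itself.\<close>

lemma gadget_square: "gadget (\<lambda>a. int a * int a)"
proof -
  define A :: "int mat" where "A = mat 3 3 (\<lambda>(i, j). if i \<le> j then if i = 1 \<and> j = 2 then 2 else 1 else 0)"
  have "A ^\<^sub>m a = mat 3 3 (\<lambda>(i, j). if i = j then 1 else if i < j then
      if i = 1 then 2 * int a else if j = 1 then int a else int a * int a else 0)" for a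
  proof (induction a)
    case 0
    show ?case by (auto simp: A_def)
  next
    case (Suc a)
    show ?case
      unfolding pow_mat.simps Suc
      by (rule eq_matI) (auto simp: A_def scalar_prod_def numeral_3_eq_3 numeral_2_eq_2 less_Suc_eq algebra_simps)
  qed
  then show ?thesis
    unfolding gadget_def by (intro exI[of _ 3] conjI bexI[of _ A]) (auto simp: A_def)
qed

text \<open>The matrix \<open>A\<close> has one diagonal block per factor, and \<open>B\<close> has
  zero diagonal blocks and single ones linking consecutive blocks. Each occurrence of
  \<open>B\<close> thus forces a move to the next block, so the only path to the corner reads the
  \<open>i\<close>-th exponent in the \<open>i\<close>-th block.\<close>

lemma monomial_word_mat:
  assumes "\<forall>f\<in>set fs. gadget f" "fs \<noteq> []"
  shows "\<exists>k>0. \<exists>A\<in>carrier_mat k k. \<exists>B\<in>carrier_mat k k. upper_triangular A \<and> upper_triangular B \<and>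
    (\<forall>as. length as = length fs \<longrightarrow> word_mat k A B as $$ (0, k - 1) = (\<Prod>i<length fs. (fs ! i) (as ! i)))"
  using assms
proof (induction fs rule: induct_list012)
  case (2 f)
  then obtain k A where k: "k > 0" "A \<in> carrier_mat k k" "upper_triangular A" "\<And>a. (A ^\<^sub>m a) $$ (0, k - 1) = f a"
    by (auto simp: gadget_def)
  have "word_mat k A (0\<^sub>m k k) as $$ (0, k - 1) = (\<Prod>i<length [f]. ([f] ! i) (as ! i))"
    if "length as = length [f]" for as
    using that k(4) by (cases as) auto
  then show ?case using k(1-3) by (intro exI[of _ k] conjI bexI[of _ A] bexI[of _ "0\<^sub>m k k"]) auto
next
  case (3 f g fs)
  obtain k A where k: "k > 0" "A \<in> carrier_mat k k" "upper_triangular A" "\<And>a. (A ^\<^sub>m a) $$ (0, k - 1) = f a"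
    using 3(3) by (auto simp: gadget_def)
  obtain l A' B' where l: "l > 0" "A' \<in> carrier_mat l l" "B' \<in> carrier_mat l l" "upper_triangular A'" "upper_triangular B'"
    "\<And>as. length as = length (g # fs) \<Longrightarrow> word_mat l A' B' as $$ (0, l - 1) = (\<Prod>i<length (g # fs). ((g # fs) ! i) (as ! i))"
    using 3 by auto
  define E :: "int mat" where "E = mat k l (\<lambda>(i, j). if i = k - 1 \<and> j = 0 then 1 else 0)"
  have E: "E \<in> carrier_mat k l" by (simp add: E_def)
  let ?A = "tri k l A (0\<^sub>m k l) A'" and ?B = "tri k l (0\<^sub>m k k) E B'"
  have "word_mat (k + l) ?A ?B as $$ (0, k + l - 1) = (\<Prod>i<length (f # g # fs). ((f # g # fs) ! i) (as ! i))"
    if as: "length as = length (f # g # fs)" for as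
  proof -
    obtain a b as' where as': "as = a # b # as'" "length (b # as') = length (g # fs)"
      using as by (cases as; cases "tl as") auto
    let ?M = "word_mat k A (0\<^sub>m k k) (b # as')" and ?M' = "word_mat l A' B' (b # as')"
    obtain Q where Q: "Q \<in> carrier_mat k l" "word_mat (k + l) ?A ?B (b # as') = tri k l ?M Q ?M'"
      using tri_word_mat[OF k(2) l(2) zero_carrier_mat E l(3)] by blast
    have M: "?M \<in> carrier_mat k k" "?M' \<in> carrier_mat l l"
      using k l by simp_all
    have EM: "E * ?M' = mat k l (\<lambda>(i, j). if i = k - 1 then ?M' $$ (0, j) else 0)"
    proof (rule eq_matI)
      fix i j assume "i < dim_row (mat k l (\<lambda>(i, j). if i = k - 1 then ?M' $$ (0, j) else 0))"
        and "j < dim_col (mat k l (\<lambda>(i, j). if i = k - 1 then ?M' $$ (0, j) else 0))"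
      then have ij: "i < k" "j < l" by simp_all
      have "(E * ?M') $$ (i, j) = (\<Sum>n\<in>{0..<l}. (if i = k - 1 \<and> n = 0 then 1 else 0) * ?M' $$ (n, j))"
        using ij M E by (simp add: scalar_prod_def E_def)
      also have "\<dots> = (\<Sum>n\<in>{0..<l}. if n = 0 then (if i = k - 1 then ?M' $$ (0, j) else 0) else 0)"
        by (intro sum.cong) auto
      also have "\<dots> = (if i = k - 1 then ?M' $$ (0, j) else 0)"
        using l(1) by simp
      finally show "(E * ?M') $$ (i, j) = mat k l (\<lambda>(i, j). if i = k - 1 then ?M' $$ (0, j) else 0) $$ (i, j)"
        using ij by simp
    qed (use M E in auto)
    have c: "0\<^sub>m k k * Q + E * ?M' = E * ?M'" "E * ?M' \<in> carrier_mat k l" "B' * ?M' \<in> carrier_mat l l"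
      "0\<^sub>m k k * ?M \<in> carrier_mat k k" "A ^\<^sub>m a \<in> carrier_mat k k" "A' ^\<^sub>m a \<in> carrier_mat l l"
      using M E Q(1) k l by (auto intro!: mult_carrier_mat[OF zero_carrier_mat] mult_carrier_mat[OF E]
        mult_carrier_mat[OF l(3)] simp: left_mult_zero_mat[OF Q(1)])
    have "word_mat (k + l) ?A ?B as =
        tri k l (A ^\<^sub>m a) (0\<^sub>m k l) (A' ^\<^sub>m a) * tri k l (0\<^sub>m k k * ?M) (E * ?M') (B' * ?M')"
      unfolding as'(1) word_mat.simps Q(2) tri_pow[OF k(2) l(2)]
      using c(1) by (simp only: tri_mult[OF zero_carrier_mat E l(3) M(1) Q(1) M(2)])
    also have "\<dots> = tri k l (A ^\<^sub>m a * (0\<^sub>m k k * ?M)) (A ^\<^sub>m a * (E * ?M') + 0\<^sub>m k l * (B' * ?M')) (A' ^\<^sub>m a * (B' * ?M'))"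
      by (rule tri_mult) (use c in auto)
    also have "\<dots> $$ (0, k + (l - 1)) = (A ^\<^sub>m a * (E * ?M') + 0\<^sub>m k l * (B' * ?M')) $$ (0, l - 1)"
      using k(1) l(1) c by (intro tri_index) auto
    also have "\<dots> = (A ^\<^sub>m a * (E * ?M')) $$ (0, l - 1)"
      using c k(1) l(1) by (simp add: left_mult_zero_mat[OF c(3)])
    also have "\<dots> = (\<Sum>n\<in>{0..<k}. (A ^\<^sub>m a) $$ (0, n) * (if n = k - 1 then ?M' $$ (0, l - 1) else 0))"
    proof -
      have "dim_row (A ^\<^sub>m a) = k" "dim_col (A ^\<^sub>m a) = k" using c(5) by auto
      then show ?thesis using k(1) l(1) by (simp add: EM scalar_prod_def cong: if_cong)
    qed
    also have "\<dots> = (\<Sum>n\<in>{0..<k}. if n = k - 1 then (A ^\<^sub>m a) $$ (0, k - 1) * ?M' $$ (0, l - 1) else 0)"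
      by (intro sum.cong) auto
    also have "\<dots> = (A ^\<^sub>m a) $$ (0, k - 1) * ?M' $$ (0, l - 1)"
      using k(1) by simp
    also have "\<dots> = f a * (\<Prod>i<length (g # fs). ((g # fs) ! i) ((b # as') ! i))"
      using k(4) l(6)[OF as'(2)] by simp
    also have "\<dots> = (\<Prod>i<length (f # g # fs). ((f # g # fs) ! i) (as ! i))"
      unfolding as'(1) length_Cons[of f] prod.lessThan_Suc_shift by simp
    finally show ?thesis using l(1) by simp
  qed
  moreover have "?A \<in> carrier_mat (k + l) (k + l)" "?B \<in> carrier_mat (k + l) (k + l)"
    "upper_triangular ?A" "upper_triangular ?B"
    using k l by (auto intro!: tri_upper_triangular)
  ultimately show ?case
    using k(1) by (intro exI[of _ "k + l"] conjI bexI[of _ ?A] bexI[of _ ?B]) auto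
qed simp

text \<open>The first argument of the functions below is the parameter \<open>e\<close> of the family of morphisms.
  It may only enter as a literal entry, which keeps the code of the morphism computable in \<open>e\<close>.\<close>

definition literal :: "(nat \<Rightarrow> int) \<Rightarrow> bool" where
  "literal g \<longleftrightarrow> (\<exists>c. \<forall>e. g e = c) \<or> (\<forall>e. g e = int e)"

text \<open>The vectors \<open>u e\<close> and \<open>v\<close> later become a row of the image of
  \<open>Z1\<close> and a column of the image of \<open>Z2\<close>. The parameter is confined to
  \<open>u\<close>.\<close>

definition realizable :: "nat \<Rightarrow> (nat \<Rightarrow> nat list \<Rightarrow> int) \<Rightarrow> bool" where
  "realizable t F \<longleftrightarrow> (\<exists>k A B u v. 0 < k \<and> A \<in> carrier_mat k k \<and> B \<in> carrier_mat k k \<and>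
     upper_triangular A \<and> upper_triangular B \<and> v \<in> carrier_vec k \<and>
     (\<forall>e. u e \<in> carrier_vec k) \<and> (\<forall>i<k. literal (\<lambda>e. u e $ i)) \<and>
     (\<forall>e as. length as = t \<longrightarrow> F e as = u e \<bullet> (word_mat k A B as *\<^sub>v v)))"

lemma literal_const [simp]: "literal (\<lambda>_. c)"
  by (simp add: literal_def)

lemma realizable_monomial:
  assumes "literal g" "\<And>i. gadget (\<phi> i)" "0 < t"
  shows "realizable t (\<lambda>e as. g e * (\<Prod>i<t. \<phi> i (as ! i)))"
proof -
  obtain k A B where k: "0 < k" "A \<in> carrier_mat k k" "B \<in> carrier_mat k k" "upper_triangular A" "upper_triangular B"
    and eq: "\<And>as. length as = t \<Longrightarrow> word_mat k A B as $$ (0, k - 1) = (\<Prod>i<t. \<phi> i (as ! i))"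
    using monomial_word_mat[of "map \<phi> [0..<t]"] assms(2,3) by auto
  have "(g e \<cdot>\<^sub>v unit_vec k 0) \<bullet> (word_mat k A B as *\<^sub>v unit_vec k (k - 1)) = g e * word_mat k A B as $$ (0, k - 1)" for e as
  proof -
    have M: "word_mat k A B as \<in> carrier_mat k k" using k by simp
    have "(unit_vec k 0 :: int vec) \<bullet> (word_mat k A B as *\<^sub>v unit_vec k (k - 1)) = word_mat k A B as $$ (0, k - 1)"
      using M k(1) by simp
    then show ?thesis using M by simp
  qed
  moreover have "literal (\<lambda>e. (g e \<cdot>\<^sub>v unit_vec k 0) $ i)" if "i < k" for i
    using assms(1) that by (cases "i = 0") simp_all
  ultimately show ?thesis
    unfolding realizable_def using k eq
    by (intro exI[of _ k] exI[of _ A] exI[of _ B] exI[of _ "\<lambda>e. g e \<cdot>\<^sub>v unit_vec k 0"] exI[of _ "unit_vec k (k - 1)"])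
      simp
qed

text \<open>Direct sums of the matrices and concatenation of the vectors add the scalar
  products.\<close>

lemma realizable_add:
  assumes "realizable t F" "realizable t G"
  shows "realizable t (\<lambda>e as. F e as + G e as)"
proof -
  obtain k A B u v where k: "0 < k" "A \<in> carrier_mat k k" "B \<in> carrier_mat k k" "upper_triangular A" "upper_triangular B"
    "v \<in> carrier_vec k" "\<And>e. u e \<in> carrier_vec k" "\<And>i. i < k \<Longrightarrow> literal (\<lambda>e. u e $ i)"
    and F: "\<And>e as. length as = t \<Longrightarrow> F e as = u e \<bullet> (word_mat k A B as *\<^sub>v v)"
    using assms(1) unfolding realizable_def by blast
  obtain l A' B' u' v' where l: "0 < l" "A' \<in> carrier_mat l l" "B' \<in> carrier_mat l l" "upper_triangular A'" "upper_triangular B'"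
    "v' \<in> carrier_vec l" "\<And>e. u' e \<in> carrier_vec l" "\<And>i. i < l \<Longrightarrow> literal (\<lambda>e. u' e $ i)"
    and G: "\<And>e as. length as = t \<Longrightarrow> G e as = u' e \<bullet> (word_mat l A' B' as *\<^sub>v v')"
    using assms(2) unfolding realizable_def by blast
  let ?A = "tri k l A (0\<^sub>m k l) A'" and ?B = "tri k l B (0\<^sub>m k l) B'"
  have "F e as + G e as = (u e @\<^sub>v u' e) \<bullet> (word_mat (k + l) ?A ?B as *\<^sub>v (v @\<^sub>v v'))"
    if "length as = t" for e as
  proof -
    have "word_mat (k + l) ?A ?B as *\<^sub>v (v @\<^sub>v v') = (word_mat k A B as *\<^sub>v v) @\<^sub>v (word_mat l A' B' as *\<^sub>v v')"
        unfolding tri_word_mat_diag[OF k(2) l(2) k(3) l(3)] unfolding tri_def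
      by (rule mult_mat_vec_split) (use k l in auto)
    moreover have "(u e @\<^sub>v u' e) \<bullet> ((word_mat k A B as *\<^sub>v v) @\<^sub>v (word_mat l A' B' as *\<^sub>v v')) =
        u e \<bullet> (word_mat k A B as *\<^sub>v v) + u' e \<bullet> (word_mat l A' B' as *\<^sub>v v')"
      by (rule scalar_prod_append) (use k l in \<open>auto intro!: mult_mat_vec_carrier\<close>)
    ultimately show ?thesis using F G that by simp
  qed
  moreover have "literal (\<lambda>e. (u e @\<^sub>v u' e) $ i)" if "i < k + l" for i
  proof -
    have "dim_vec (u e) = k" "dim_vec (u' e) = l" for e using k(7) l(7) by auto
    then show ?thesis using that k(8)[of i] l(8)[of "i - k"] by (cases "i < k") auto
  qed
  ultimately show ?thesis
    unfolding realizable_def using k l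
    by (intro exI[of _ "k + l"] exI[of _ ?A] exI[of _ ?B] exI[of _ "\<lambda>e. u e @\<^sub>v u' e"] exI[of _ "v @\<^sub>v v'"])
      (simp add: tri_upper_triangular)
qed

lemma realizable_cong:
  "realizable t F \<Longrightarrow> (\<And>e as. length as = t \<Longrightarrow> G e as = F e as) \<Longrightarrow> realizable t G"
  unfolding realizable_def by metis

section \<open>Morphisms\<close>

lemma morph_word_simps [simp]:
  "morph_word k \<mu> [] = 1\<^sub>m k"
  "morph_word k \<mu> (c # w) = \<mu> c * morph_word k \<mu> w"
  by (simp_all add: morph_word_def)

lemma morph_word_carrier [simp]:
  "(\<And>c. \<mu> c \<in> carrier_mat k k) \<Longrightarrow> morph_word k \<mu> w \<in> carrier_mat k k"
  by (induction w) (auto intro!: mult_carrier_mat)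

lemma morph_word_append:
  assumes "\<And>c. \<mu> c \<in> carrier_mat k k"
  shows "morph_word k \<mu> (v @ w) = morph_word k \<mu> v * morph_word k \<mu> w"
proof (induction v)
  case Nil
  have "morph_word k \<mu> w \<in> carrier_mat k k" using assms by (rule morph_word_carrier)
  then show ?case using left_mult_one_mat by simp
next
  case (Cons c v)
  then show ?case
    using assoc_mult_mat[OF assms morph_word_carrier[OF assms] morph_word_carrier[OF assms]] by simp
qed

lemma morph_word_replicate:
  assumes "\<And>c. \<mu> c \<in> carrier_mat k k"
  shows "morph_word k \<mu> (replicate a c) = \<mu> c ^\<^sub>m a"
proof (induction a)
  case 0
  show ?case using assms[of c] by simp
next
  case (Suc a)
  have "morph_word k \<mu> (replicate (Suc a) c) = morph_word k \<mu> (replicate a c @ [c])"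
    by (simp only: replicate_append_same replicate_Suc)
  also have "\<dots> = \<mu> c ^\<^sub>m a * (\<mu> c * 1\<^sub>m k)"
    using Suc by (simp only: morph_word_append[OF assms] morph_word_simps)
  finally show ?case using assms[of c] by simp
qed

lemma morph_word_xy_block:
  assumes "\<And>c. \<mu> c \<in> carrier_mat k k"
  shows "morph_word k \<mu> (xy_block as) = word_mat k (\<mu> X) (\<mu> Y) as"
proof (induction as rule: xy_block.induct)
  case (3 a b as)
  then show ?case by (simp add: morph_word_append[OF assms] morph_word_replicate[OF assms])
qed (simp_all add: morph_word_replicate[OF assms])

definition K_word :: "nat list \<Rightarrow> letter list" where
  "K_word as = [Z1] @ xy_block as @ [Z2]"

lemma K_eq: "K t = K_word ` {as. length as = t}"
  by (auto simp: K_def K_word_def)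

lemma length_xy_block: "as \<noteq> [] \<Longrightarrow> Suc (length (xy_block as)) = sum_list as + length as"
  by (induction as rule: xy_block.induct) auto

lemma morph_word_K_word:
  assumes "\<And>c. \<mu> c \<in> carrier_mat k k"
  shows "morph_word k \<mu> (K_word as) = \<mu> Z1 * (word_mat k (\<mu> X) (\<mu> Y) as * \<mu> Z2)"
  using assms[of Z2] unfolding K_word_def
  by (simp add: morph_word_append[OF assms] morph_word_xy_block[OF assms])

definition family :: "nat \<Rightarrow> (nat \<Rightarrow> letter \<Rightarrow> int mat) \<Rightarrow> bool" where
  "family k \<mu> \<longleftrightarrow> (\<forall>e. \<mu> e \<in> uptr_morphisms k) \<and>
     (\<forall>c i j. i < k \<longrightarrow> j < k \<longrightarrow> literal (\<lambda>e. \<mu> e c $$ (i, j)))"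

lemma familyD:
  assumes "family k \<mu>"
  shows "\<mu> e c \<in> carrier_mat k k" "upper_triangular (\<mu> e c)"
    "i < k \<Longrightarrow> j < k \<Longrightarrow> literal (\<lambda>e. \<mu> e c $$ (i, j))"
  using assms unfolding family_def uptr_morphisms_def by blast+

text \<open>Recording only which words collide makes it possible to combine several output functions
  by a conjunction, without describing the whole matrix.\<close>

definition separates :: "nat \<Rightarrow> (nat \<Rightarrow> nat list \<Rightarrow> nat list \<Rightarrow> bool) \<Rightarrow> bool" where
  "separates t P \<longleftrightarrow> (\<exists>k \<mu>. 0 < k \<and> family k \<mu> \<and> (\<forall>e as bs. length as = t \<longrightarrow> length bs = t \<longrightarrow>
     (morph_word k (\<mu> e) (K_word as) = morph_word k (\<mu> e) (K_word bs) \<longleftrightarrow> P e as bs)))"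

lemma separates_realizable:
  assumes "realizable t F"
  shows "separates t (\<lambda>e as bs. F e as = F e bs)"
proof -
  obtain k A B u v where k: "0 < k" "A \<in> carrier_mat k k" "B \<in> carrier_mat k k" "upper_triangular A" "upper_triangular B"
    "v \<in> carrier_vec k" "\<And>e. u e \<in> carrier_vec k" "\<And>i. i < k \<Longrightarrow> literal (\<lambda>e. u e $ i)"
    and F: "\<And>e as. length as = t \<Longrightarrow> F e as = u e \<bullet> (word_mat k A B as *\<^sub>v v)"
    using assms unfolding realizable_def by blast
  \<comment> \<open>All rows of \<open>U e\<close> except the first and all columns of
    \<open>V\<close> except the last vanish. Both are upper triangular, and
    \<open>U e * (M * V)\<close> is zero outside its upper right corner, which is the scalar product
    of \<open>u e\<close> with \<open>M\<close> applied to \<open>v\<close>.\<close>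
  define U where "U e = mat k k (\<lambda>(i, j). if i = 0 then u e $ j else 0)" for e
  define V where "V = mat k k (\<lambda>(i, j). if j = k - 1 then v $ i else 0)"
  define \<mu> where "\<mu> e c = (case c of X \<Rightarrow> A | Y \<Rightarrow> B | Z1 \<Rightarrow> U e | Z2 \<Rightarrow> V)" for e c
  have UV: "U e \<in> carrier_mat k k" "V \<in> carrier_mat k k" for e
    by (simp_all add: U_def V_def)
  have car: "\<mu> e c \<in> carrier_mat k k" for e c
    using k UV by (cases c) (simp_all add: \<mu>_def)
  have "upper_triangular (U e)" "upper_triangular V" for e
    by (auto simp: U_def V_def)
  then have "upper_triangular (\<mu> e c)" for e c
    using k by (cases c) (simp_all add: \<mu>_def)
  moreover have "literal (\<lambda>e. \<mu> e c $$ (i, j))" if "i < k" "j < k" for c i j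
    using that k(8)[of j] by (cases c; cases "i = 0") (simp_all add: \<mu>_def U_def)
  ultimately have "family k \<mu>"
    using car by (simp add: family_def uptr_morphisms_def)
  moreover have "morph_word k (\<mu> e) (K_word as) = morph_word k (\<mu> e) (K_word bs) \<longleftrightarrow> F e as = F e bs"
    if "length as = t" "length bs = t" for e as bs
  proof -
    have eq: "morph_word k (\<mu> e) (K_word cs) = mat k k (\<lambda>(i, j). if i = 0 \<and> j = k - 1 then F e cs else 0)"
      if cs: "length cs = t" for cs
    proof -
      let ?M = "word_mat k A B cs"
      have M: "?M \<in> carrier_mat k k" using k by simp
      have colV: "col V j = (if j = k - 1 then v else 0\<^sub>v k)" if "j < k" for j
        using k(6) that by (auto simp: V_def)
      have MV: "?M * V = mat k k (\<lambda>(i, j). if j = k - 1 then (?M *\<^sub>v v) $ i else 0)"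
        using M UV k(6) by (intro eq_matI) (auto simp: colV intro!: scalar_prod_right_zero)
      have colMV: "col (?M * V) j = (if j = k - 1 then ?M *\<^sub>v v else 0\<^sub>v k)" if "j < k" for j
        unfolding MV using M that by (auto intro!: eq_vecI)
      have rowU: "row (U e) i = (if i = 0 then u e else 0\<^sub>v k)" if "i < k" for i
        using k(7)[of e] that by (auto simp: U_def intro!: eq_vecI)
      have Mv: "?M *\<^sub>v v \<in> carrier_vec k" using M k(6) by simp
      have "U e * (?M * V) = mat k k (\<lambda>(i, j). if i = 0 \<and> j = k - 1 then u e \<bullet> (?M *\<^sub>v v) else 0)"
      proof (rule eq_matI)
        fix i j
        assume "i < dim_row (mat k k (\<lambda>(i, j). if i = 0 \<and> j = k - 1 then u e \<bullet> (?M *\<^sub>v v) else 0))"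
          "j < dim_col (mat k k (\<lambda>(i, j). if i = 0 \<and> j = k - 1 then u e \<bullet> (?M *\<^sub>v v) else 0))"
        then have ij: "i < k" "j < k" by simp_all
        have "(U e * (?M * V)) $$ (i, j) = row (U e) i \<bullet> col (?M * V) j"
          using ij UV(1)[of e] UV(2) M by simp
        then show "(U e * (?M * V)) $$ (i, j) =
            mat k k (\<lambda>(i, j). if i = 0 \<and> j = k - 1 then u e \<bullet> (?M *\<^sub>v v) else 0) $$ (i, j)"
          using ij Mv k(7)[of e] by (simp add: rowU colMV)
      qed (use UV M in auto)
      moreover have "morph_word k (\<mu> e) (K_word cs) = U e * (?M * V)"
        by (simp add: morph_word_K_word[OF car] \<mu>_def)
      ultimately show ?thesis
        unfolding F[OF cs] by simp
    qed
    show ?thesis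
      unfolding eq[OF that(1)] eq[OF that(2)]
    proof
      assume "mat k k (\<lambda>(i, j). if i = 0 \<and> j = k - 1 then F e as else 0) =
        mat k k (\<lambda>(i, j). if i = 0 \<and> j = k - 1 then F e bs else 0)"
      from arg_cong[OF this, of "\<lambda>M. M $$ (0, k - 1)"] show "F e as = F e bs"
        using k(1) by simp
    qed (simp cong: if_cong)
  qed
  ultimately show ?thesis
    unfolding separates_def using k(1) by blast
qed

lemma morph_word_tri:
  assumes "\<And>c. \<mu> c \<in> carrier_mat k k" "\<And>c. \<nu> c \<in> carrier_mat l l"
  shows "morph_word (k + l) (\<lambda>c. tri k l (\<mu> c) (0\<^sub>m k l) (\<nu> c)) w =
    tri k l (morph_word k \<mu> w) (0\<^sub>m k l) (morph_word l \<nu> w)"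
proof (induction w)
  case Nil
  show ?case by (simp add: tri_def)
next
  case (Cons c w)
  then show ?case
    using assms by (simp add: tri_mult_diag)
qed

text \<open>In a block diagonal morphism two words collide exactly if they collide in both
  blocks.\<close>

lemma separates_conj:
  assumes "separates t P" "separates t Q"
  shows "separates t (\<lambda>e as bs. P e as bs \<and> Q e as bs)"
proof -
  obtain k \<mu> where k: "0 < k" "family k \<mu>" and P: "\<And>e as bs. length as = t \<Longrightarrow> length bs = t \<Longrightarrow>
     morph_word k (\<mu> e) (K_word as) = morph_word k (\<mu> e) (K_word bs) \<longleftrightarrow> P e as bs"
    using assms(1) unfolding separates_def by blast
  obtain l \<nu> where l: "family l \<nu>" and Q: "\<And>e as bs. length as = t \<Longrightarrow> length bs = t \<Longrightarrow>
     morph_word l (\<nu> e) (K_word as) = morph_word l (\<nu> e) (K_word bs) \<longleftrightarrow> Q e as bs"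
    using assms(2) unfolding separates_def by blast
  define \<kappa> where "\<kappa> e c = tri k l (\<mu> e c) (0\<^sub>m k l) (\<nu> e c)" for e c
  note car = familyD(1)[OF k(2)] familyD(1)[OF l]
  have "literal (\<lambda>e. \<kappa> e c $$ (i, j))" if ij: "i < k + l" "j < k + l" for c i j
  proof -
    have "dim_row (\<mu> e c) = k" "dim_col (\<mu> e c) = k" "dim_row (\<nu> e c) = l" "dim_col (\<nu> e c) = l" for e
      using familyD(1)[OF k(2), of e c] familyD(1)[OF l, of e c] by auto
    then show ?thesis
      using ij familyD(3)[OF k(2), of i j c] familyD(3)[OF l, of "i - k" "j - k" c]
      by (cases "i < k"; cases "j < k") (simp_all add: \<kappa>_def tri_def)
  qed
  then have "family (k + l) \<kappa>"
    using car familyD(2)[OF k(2)] familyD(2)[OF l]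
    by (simp add: family_def uptr_morphisms_def \<kappa>_def tri_upper_triangular)
  moreover have "morph_word (k + l) (\<kappa> e) (K_word as) = morph_word (k + l) (\<kappa> e) (K_word bs) \<longleftrightarrow> P e as bs \<and> Q e as bs"
    if "length as = t" "length bs = t" for e as bs
    unfolding \<kappa>_def morph_word_tri[OF car]
    using P[OF that] Q[OF that] tri_eq_iff[OF morph_word_carrier[OF car(1)] morph_word_carrier[OF car(2)]
        morph_word_carrier[OF car(1)] morph_word_carrier[OF car(2)] zero_carrier_mat]
    by simp
  ultimately show ?thesis
    unfolding separates_def using k(1) by (intro exI[of _ "k + l"] exI[of _ \<kappa>]) auto
qed

lemma separates_all:
  assumes "Fs \<noteq> []" "\<And>F. F \<in> set Fs \<Longrightarrow> realizable t F"
  shows "separates t (\<lambda>e as bs. \<forall>F\<in>set Fs. F e as = F e bs)"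
  using assms
proof (induction Fs rule: induct_list012)
  case (2 F)
  then show ?case using separates_realizable[of t F] by simp
next
  case (3 F G Fs)
  have "separates t (\<lambda>e as bs. F e as = F e bs \<and> (\<forall>F\<in>set (G # Fs). F e as = F e bs))"
    using 3 by (intro separates_conj separates_realizable) auto
  then show ?case by simp
qed simp

section \<open>The output functions\<close>

lemma prod_update:
  fixes \<phi> :: "nat \<Rightarrow> nat \<Rightarrow> int"
  assumes "j < t" "\<phi> j = (\<lambda>_. 1)"
  shows "(\<Prod>i<t. (\<phi>(j := f)) i (as ! i)) = f (as ! j) * (\<Prod>i<t. \<phi> i (as ! i))"
proof -
  have "(\<Prod>i<t. (\<phi>(j := f)) i (as ! i)) = f (as ! j) * (\<Prod>i\<in>{..<t} - {j}. (\<phi>(j := f)) i (as ! i))"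
    using assms(1) by (subst prod.remove[of _ j]) auto
  also have "(\<Prod>i\<in>{..<t} - {j}. (\<phi>(j := f)) i (as ! i)) = (\<Prod>i\<in>{..<t} - {j}. \<phi> i (as ! i))"
    by (intro prod.cong) auto
  also have "\<dots> = (\<Prod>i<t. \<phi> i (as ! i))"
    using assms by (subst (2) prod.remove[of _ j]) auto
  finally show ?thesis .
qed

lemma prod_update1:
  "j < t \<Longrightarrow> (\<Prod>i<t. ((\<lambda>_ _. 1)(j := f)) i (as ! i)) = (f (as ! j) :: int)" for as :: "nat list"
  using prod_update[of j t "\<lambda>_ _. 1" f as] by (simp del: fun_upd_apply)

lemma prod_update2:
  "j < t \<Longrightarrow> k < t \<Longrightarrow> j \<noteq> k \<Longrightarrow>
    (\<Prod>i<t. ((\<lambda>_ _. 1)(k := h, j := f)) i (as ! i)) = (f (as ! j) * h (as ! k) :: int)" for as :: "nat list"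
  by (subst prod_update) (simp_all add: prod_update1 fun_upd_other del: fun_upd_apply)

lemma prod_update3:
  "j < t \<Longrightarrow> k < t \<Longrightarrow> l < t \<Longrightarrow> j \<noteq> k \<Longrightarrow> j \<noteq> l \<Longrightarrow> k \<noteq> l \<Longrightarrow>
    (\<Prod>i<t. ((\<lambda>_ _. 1)(l := d, k := h, j := f)) i (as ! i)) =
    (f (as ! j) * (h (as ! k) * d (as ! l)) :: int)" for as :: "nat list"
  by (subst prod_update) (simp_all add: prod_update2 fun_upd_other del: fun_upd_apply)

lemma realizable_factor1:
  assumes "literal g" "gadget f" "j < t"
  shows "realizable t (\<lambda>e as. g e * f (as ! j))"
proof -
  have "realizable t (\<lambda>e as. g e * (\<Prod>i<t. ((\<lambda>_ _. 1)(j := f)) i (as ! i)))"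
    using assms gadget_one by (intro realizable_monomial) auto
  then show ?thesis
    by (rule realizable_cong) (simp add: prod_update1 assms del: fun_upd_apply)
qed

lemma realizable_factor2:
  assumes "literal g" "gadget f" "gadget h" "j < t" "k < t" "j \<noteq> k"
  shows "realizable t (\<lambda>e as. g e * (f (as ! j) * h (as ! k)))"
proof -
  have "realizable t (\<lambda>e as. g e * (\<Prod>i<t. ((\<lambda>_ _. 1)(k := h, j := f)) i (as ! i)))"
    using assms gadget_one by (intro realizable_monomial) auto
  then show ?thesis
    by (rule realizable_cong) (simp add: prod_update2 assms del: fun_upd_apply)
qed

lemma realizable_factor3:
  assumes "literal g" "gadget f" "gadget h" "gadget d" "j < t" "k < t" "l < t" "j \<noteq> k" "j \<noteq> l" "k \<noteq> l"
  shows "realizable t (\<lambda>e as. g e * (f (as ! j) * (h (as ! k) * d (as ! l))))"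
proof -
  have "realizable t (\<lambda>e as. g e * (\<Prod>i<t. ((\<lambda>_ _. 1)(l := d, k := h, j := f)) i (as ! i)))"
    using assms gadget_one by (intro realizable_monomial) auto
  then show ?thesis
    by (rule realizable_cong) (simp add: prod_update3 assms del: fun_upd_apply)
qed

fun defect :: "atom \<Rightarrow> (nat \<Rightarrow> nat) \<Rightarrow> int" where
  "defect (Const i c) v = int (v i) - int c"
| "defect (Add i j k) v = int (v i) - (int (v j) + int (v k))"
| "defect (Mul i j k) v = int (v i) - int (v j) * int (v k)"
| "defect (Pow i j) v = int (v i) - 2 ^ v j"

lemma defect_eq_0_iff: "defect a v = 0 \<longleftrightarrow> sat v a"
proof (cases a)
  case (Mul i j k)
  then show ?thesis by (simp flip: of_nat_mult)
next
  case (Pow i j)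
  have "int (v i) = 2 ^ v j \<longleftrightarrow> v i = 2 ^ v j"
    using of_nat_eq_iff[of "v i" "2 ^ v j", where ?'a = int] by simp
  then show ?thesis using Pow by simp
qed auto

lemma realizable_defect:
  assumes "vars a \<subseteq> {..<m}"
  shows "realizable (Suc m) (\<lambda>e as. int (as ! m) * defect a (\<lambda>i. as ! i))"
proof (cases a)
  case (Const i c)
  have "realizable (Suc m) (\<lambda>e as. 1 * (int (as ! i) * int (as ! m)) + (- int c) * int (as ! m))"
    using assms Const by (intro realizable_add realizable_factor1 realizable_factor2 gadget_id literal_const) auto
  then show ?thesis
    by (rule realizable_cong) (simp add: Const algebra_simps)
next
  case (Add i j k)
  have "realizable (Suc m) (\<lambda>e as. 1 * (int (as ! i) * int (as ! m)) +
      ((- 1) * (int (as ! j) * int (as ! m)) + (- 1) * (int (as ! k) * int (as ! m))))"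
    using assms Add by (intro realizable_add realizable_factor2 gadget_id literal_const) auto
  then show ?thesis
    by (rule realizable_cong) (simp add: Add algebra_simps)
next
  case (Mul i j k)
  \<comment> \<open>A monomial has a single factor per exponent, so the case \<open>j = k\<close>
    takes the square gadget.\<close>
  show ?thesis
  proof (cases "j = k")
    case True
    have "realizable (Suc m) (\<lambda>e as. 1 * (int (as ! i) * int (as ! m)) +
        (- 1) * ((\<lambda>a. int a * int a) (as ! j) * int (as ! m)))"
      using assms Mul by (intro realizable_add realizable_factor2 gadget_id gadget_square literal_const) auto
    then show ?thesis
      by (rule realizable_cong) (simp add: Mul True algebra_simps)
  next
    case False
    have "realizable (Suc m) (\<lambda>e as. 1 * (int (as ! i) * int (as ! m)) +
        (- 1) * (int (as ! j) * (int (as ! k) * int (as ! m))))"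
      using assms Mul False
      by (intro realizable_add realizable_factor2 realizable_factor3 gadget_id literal_const) auto
    then show ?thesis
      by (rule realizable_cong) (simp add: Mul algebra_simps)
  qed
next
  case (Pow i j)
  have "realizable (Suc m) (\<lambda>e as. 1 * (int (as ! i) * int (as ! m)) +
      (- 1) * ((\<lambda>a. 2 ^ a) (as ! j) * int (as ! m)))"
    using assms Pow by (intro realizable_add realizable_factor2 gadget_id gadget_power literal_const) auto
  then show ?thesis
    by (rule realizable_cong) (simp add: Pow algebra_simps)
qed

text \<open>The sign matters: \<open>int e\<close> is a literal coefficient, whereas its negative is
  not.\<close>

lemma realizable_parameter:
  assumes "0 < m"
  shows "realizable (Suc m) (\<lambda>e as. int (as ! m) * (int e - int (as ! 0)))"
proof -
  have "realizable (Suc m) (\<lambda>e as. int e * int (as ! m) + (- 1) * (int (as ! 0) * int (as ! m)))"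
    using assms by (intro realizable_add realizable_factor1 realizable_factor2 gadget_id literal_const)
      (auto simp: literal_def)
  then show ?thesis
    by (rule realizable_cong) (simp add: algebra_simps)
qed

text \<open>Here \<open>as ! m\<close> is the extra exponent \<open>b\<close>, which can be changed freely exactly at the solutions.\<close>

lemma injective_iff_unsolvable:
  assumes "\<And>a. a \<in> set As \<Longrightarrow> vars a \<subseteq> {..<m}" "0 < m"
  shows "\<exists>k \<mu>. 0 < k \<and> family k \<mu> \<and> (\<forall>e. inj_on (morph_word k (\<mu> e)) (K (Suc m)) \<longleftrightarrow>
    \<not> (\<exists>w. w 0 = e \<and> (\<forall>a\<in>set As. sat w a)))"
proof -
  define G where "G = (\<lambda>a (e::nat) as. int (as ! m) * defect a (\<lambda>i. as ! i))"
  define H where "H = (\<lambda>(e::nat) as. int (as ! m) * (int e - int (as ! 0)))"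
  define Fs where "Fs = map (\<lambda>i (e::nat) as. int (as ! i)) [0..<m] @ H # map G As"
  have "realizable (Suc m) (\<lambda>e as. int (as ! i))" if "i < m" for i
    using realizable_factor1[of "\<lambda>_. 1" int i "Suc m"] that gadget_id by simp
  then have "realizable (Suc m) F" if "F \<in> set Fs" for F
    using that realizable_defect[OF assms(1)] realizable_parameter[OF assms(2)]
    by (auto simp: Fs_def G_def H_def)
  then have "separates (Suc m) (\<lambda>e as bs. \<forall>F\<in>set Fs. F e as = F e bs)"
    by (intro separates_all) (auto simp: Fs_def)
  then obtain k \<mu> where k: "0 < k" "family k \<mu>"
    and sep: "\<And>e as bs. length as = Suc m \<Longrightarrow> length bs = Suc m \<Longrightarrow>
      morph_word k (\<mu> e) (K_word as) = morph_word k (\<mu> e) (K_word bs) \<longleftrightarrow> (\<forall>F\<in>set Fs. F e as = F e bs)"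
    unfolding separates_def by blast
  have Fs: "(\<forall>F\<in>set Fs. F e as = F e bs) \<longleftrightarrow> (\<forall>i<m. as ! i = bs ! i) \<and> H e as = H e bs \<and> (\<forall>a\<in>set As. G a e as = G a e bs)"
    for e as bs
    by (simp add: Fs_def ball_Un) auto
  have "inj_on (morph_word k (\<mu> e)) (K (Suc m)) \<longleftrightarrow> \<not> (\<exists>w. w 0 = e \<and> (\<forall>a\<in>set As. sat w a))" for e
  proof
    assume inj: "inj_on (morph_word k (\<mu> e)) (K (Suc m))"
    show "\<not> (\<exists>w. w 0 = e \<and> (\<forall>a\<in>set As. sat w a))"
    proof
      assume "\<exists>w. w 0 = e \<and> (\<forall>a\<in>set As. sat w a)"
      then obtain w where w: "w 0 = e" "\<And>a. a \<in> set As \<Longrightarrow> sat w a" by blast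
      define as where "as b = map w [0..<m] @ [b]" for b
      have len: "length (as b) = Suc m" for b by (simp add: as_def)
      have nth: "as b ! i = w i" if "i < m" for b i using that by (simp add: as_def nth_append)
      have "sat (\<lambda>i. as b ! i) a" if a: "a \<in> set As" for a b
        using w(2)[OF a] assms(1)[OF a] by (cases a) (auto simp: nth)
      then have "(\<forall>F\<in>set Fs. F e (as 0) = F e (as 1))"
        unfolding Fs using w(1) nth assms(2) by (auto simp: G_def H_def defect_eq_0_iff[symmetric])
      then have "morph_word k (\<mu> e) (K_word (as 0)) = morph_word k (\<mu> e) (K_word (as 1))"
        using sep[OF len len] by blast
      then have "K_word (as 0) = K_word (as 1)"
        using inj len unfolding K_eq inj_on_def by blast
      then have "xy_block (as 0) = xy_block (as 1)" by (simp add: K_word_def)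
      \<comment> \<open>The length of the word reveals the sum of the exponents, and these two sums
        differ by 1.\<close>
      then have "sum_list (as 0) = sum_list (as 1)"
        using length_xy_block[of "as 0"] length_xy_block[of "as 1"] len by (simp add: as_def)
      then show False by (simp add: as_def)
    qed
  next
    assume unsolvable: "\<not> (\<exists>w. w 0 = e \<and> (\<forall>a\<in>set As. sat w a))"
    have "as = bs" if len: "length as = Suc m" "length bs = Suc m"
      and eq: "morph_word k (\<mu> e) (K_word as) = morph_word k (\<mu> e) (K_word bs)" for as bs
    proof -
      have F: "\<And>i. i < m \<Longrightarrow> as ! i = bs ! i" "H e as = H e bs" "\<And>a. a \<in> set As \<Longrightarrow> G a e as = G a e bs"
        using sep[OF len] eq unfolding Fs by blast+
      have "as ! m = bs ! m"
      proof (rule ccontr)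
        assume ne: "as ! m \<noteq> bs ! m"
        \<comment> \<open>All variables of an atom lie below \<open>m\<close>, so both lists have
          the same defect; its products with two distinct last exponents agree only if it is
          zero.\<close>
        have "defect a (\<lambda>i. bs ! i) = defect a (\<lambda>i. as ! i)" if "a \<in> set As" for a
          using assms(1)[OF that] F(1) by (cases a) auto
        then have "defect a (\<lambda>i. as ! i) = 0" if "a \<in> set As" for a
          using F(3)[OF that] ne that by (auto simp: G_def)
        moreover have "int e - int (as ! 0) = 0"
          using F(2) F(1)[OF assms(2)] ne by (auto simp: H_def)
        ultimately show False
          using unsolvable by (auto simp: defect_eq_0_iff)
      qed
      then show ?thesis
        using len F(1) by (intro nth_equalityI) (auto simp: less_Suc_eq)
    qed
    then show "inj_on (morph_word k (\<mu> e)) (K (Suc m))"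
      unfolding K_eq inj_on_def by blast
  qed
  then show ?thesis using k by blast
qed

section \<open>Computability of the code\<close>

definition computable :: "(nat \<Rightarrow> nat) \<Rightarrow> bool" where
  "computable h \<longleftrightarrow> (\<exists>f. \<forall>e. rec_eval f [e] (h e))"

lemma rec_eval_comp1: "rec_eval g xs a \<Longrightarrow> rec_eval f [a] z \<Longrightarrow> rec_eval (Cn f [g]) xs z"
  by (rule rec_eval.comp[where ys = "[a]"]) auto

lemma rec_eval_comp2:
  "rec_eval g xs a \<Longrightarrow> rec_eval h xs b \<Longrightarrow> rec_eval f [a, b] z \<Longrightarrow> rec_eval (Cn f [g, h]) xs z"
  by (rule rec_eval.comp[where ys = "[a, b]"]) (auto simp: less_Suc_eq)

lemma rec_eval_Idf: "i < length xs \<Longrightarrow> xs ! i = y \<Longrightarrow> rec_eval (Idf i) xs y"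
  using rec_eval.proj by blast

definition add_recf :: recf where
  "add_recf = Pr (Idf 0) (Cn Sf [Idf 1])"

lemma rec_eval_add: "rec_eval add_recf [n, x] (n + x)"
proof (induction n)
  case 0
  show ?case unfolding add_recf_def by (intro rec_eval.prim0 rec_eval_Idf) auto
next
  case (Suc n)
  show ?case
    using Suc unfolding add_recf_def
    by (rule rec_eval.primS) (auto intro!: rec_eval_comp1 rec_eval_Idf rec_eval.succ)
qed

text \<open>Needed because \<open>prod_encode (m, n)\<close> is
  \<open>triangle (m + n) + m\<close>.\<close>

definition triangle_recf :: recf where
  "triangle_recf = Pr Zf (Cn add_recf [Idf 1, Cn Sf [Idf 0]])"

lemma rec_eval_triangle: "rec_eval triangle_recf [n] (triangle n)"
proof (induction n)
  case 0
  show ?case unfolding triangle_recf_def by (auto intro: rec_eval.prim0 rec_eval.zero)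
next
  case (Suc n)
  have "rec_eval (Cn add_recf [Idf 1, Cn Sf [Idf 0]]) [n, triangle n] (triangle n + Suc n)"
    by (rule rec_eval_comp2[OF _ _ rec_eval_add]) (auto intro!: rec_eval_comp1 rec_eval_Idf rec_eval.succ)
  then show ?case
    using Suc unfolding triangle_recf_def triangle_Suc by (intro rec_eval.primS)
qed

lemma computable_id: "computable (\<lambda>e. e)"
  unfolding computable_def by (rule exI[of _ "Idf 0"]) (auto intro: rec_eval_Idf)

lemma computable_Suc: "computable h \<Longrightarrow> computable (\<lambda>e. Suc (h e))"
  unfolding computable_def by (blast intro: rec_eval_comp1 rec_eval.succ)

lemma computable_const: "computable (\<lambda>e. c)"
proof (induction c)
  case 0
  show ?case unfolding computable_def by (blast intro: rec_eval.zero)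
qed (rule computable_Suc)

lemma computable_add: "computable g \<Longrightarrow> computable h \<Longrightarrow> computable (\<lambda>e. g e + h e)"
  unfolding computable_def by (blast intro: rec_eval_comp2 rec_eval_add)

lemma computable_prod_encode: "computable g \<Longrightarrow> computable h \<Longrightarrow> computable (\<lambda>e. prod_encode (g e, h e))"
proof -
  have "computable (\<lambda>e. triangle (h e))" if "computable h" for h
    using that unfolding computable_def by (blast intro: rec_eval_comp1 rec_eval_triangle)
  then show "computable g \<Longrightarrow> computable h \<Longrightarrow> computable (\<lambda>e. prod_encode (g e, h e))"
    by (simp add: prod_encode_def computable_add)
qed

lemma computable_list_encode:
  "(\<And>x. x \<in> set xs \<Longrightarrow> computable (\<lambda>e. h e x)) \<Longrightarrow> computable (\<lambda>e. list_encode (map (h e) xs))"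
  by (induction xs) (simp_all add: computable_const computable_Suc computable_prod_encode)

text \<open>\<open>int_encode\<close> doubles a nonnegative number, so for literal entries no case
  distinction on signs has to be computed.\<close>

lemma computable_literal:
  assumes "literal g"
  shows "computable (\<lambda>e. int_encode (g e))"
  using assms unfolding literal_def
proof
  assume "\<exists>c. \<forall>e. g e = c"
  then show ?thesis using computable_const by auto
next
  assume "\<forall>e. g e = int e"
  then have "int_encode (g e) = e + e" for e
    by (simp add: int_encode_def sum_encode_def)
  then show ?thesis
    using computable_add[OF computable_id computable_id] by simp
qed

lemma computable_encode_morph:
  assumes "family k \<mu>"
  shows "computable (\<lambda>e. encode_morph k (\<mu> e))"
  unfolding encode_morph_def encode_mat_def
  by (intro computable_list_encode computable_literal familyD(3)[OF assms]) auto

text \<open>For minimization, the smaller of two distinct results would be an argument at which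
  \<open>f\<close> takes both 0 and a positive value.\<close>

lemma rec_eval_unique: "rec_eval f xs y \<Longrightarrow> rec_eval f xs z \<Longrightarrow> y = z"
proof (induction arbitrary: z rule: rec_eval.induct)
  case (zero xs)
  then show ?case by (cases rule: rec_eval.cases) auto
next
  case (succ x xs)
  then show ?case by (cases rule: rec_eval.cases) auto
next
  case (proj i xs)
  from proj(2) show ?case by (cases rule: rec_eval.cases) auto
next
  case (comp ys gs xs f y)
  from comp(5) obtain ys' where ys': "length ys' = length gs" "\<And>i. i < length gs \<Longrightarrow> rec_eval (gs ! i) xs (ys' ! i)"
    "rec_eval f ys' z"
    by (cases rule: rec_eval.cases) auto
  have "ys = ys'"
    using comp.hyps(1) comp.IH(1) ys'(1,2) by (intro nth_equalityI) auto
  then show ?case using ys'(3) comp.IH(2) by simp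
next
  case (prim0 f xs y g)
  from prim0(3) have "rec_eval f xs z" by (cases rule: rec_eval.cases) auto
  then show ?case by (rule prim0(2))
next
  case (primS f g n xs y u)
  from primS(5) obtain y' where y': "rec_eval (Pr f g) (n # xs) y'" "rec_eval g (n # y' # xs) z"
    by (cases rule: rec_eval.cases) auto
  then show ?case using primS.IH(1)[OF y'(1)] primS.IH(2) by simp
next
  case (mini f n xs)
  from mini(4) have z: "rec_eval f (z # xs) 0" "\<And>m. m < z \<Longrightarrow> \<exists>y>0. rec_eval f (m # xs) y"
    by (cases rule: rec_eval.cases; auto)+
  show ?case
  proof (rule linorder_cases[of n z])
    assume "n < z"
    then obtain y where "0 < y" "rec_eval f (n # xs) y" using z(2) by blast
    then show ?thesis using mini(2) by blast
  next
    assume "z < n"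
    then obtain y where "0 < y" "\<And>u. rec_eval f (z # xs) u \<Longrightarrow> y = u" using mini(3) by blast
    then show ?thesis using z(1) by blast
  qed
qed

theorem theorem2p2:
  shows "\<exists>k t::nat. 0 < k \<and> 0 < t \<and>
    \<not> decidable_on (uptr_morphisms k) (encode_morph k)
        (\<lambda>\<mu>. inj_on (morph_word k \<mu>) (K t))"
proof -
  obtain As n where n: "n \<ge> 1"
    and R: "\<And>v. diagonal (v 0) \<longleftrightarrow> (\<exists>w. (\<forall>i<n. w i = v i) \<and> (\<forall>a\<in>set As. sat w a))"
    using dio_rename_at_least[OF dio_diagonal, of 1 "\<lambda>i. i"] by auto
  have diagonal: "diagonal e \<longleftrightarrow> (\<exists>w. w 0 = e \<and> (\<forall>a\<in>set As. sat w a))" for e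
  proof
    assume "diagonal e"
    then show "\<exists>w. w 0 = e \<and> (\<forall>a\<in>set As. sat w a)"
      \<comment> \<open>\<open>R\<close> speaks of valuations, of which only coordinate 0 matters
        here; a constant valuation serves, and \<open>n \<ge> 1\<close> gives
        \<open>w 0 = e\<close>.\<close>
      using R[of "\<lambda>_. e"] n by auto
  next
    assume "\<exists>w. w 0 = e \<and> (\<forall>a\<in>set As. sat w a)"
    then show "diagonal e" using R by blast
  qed
  have "finite (\<Union>a\<in>set As. vars a)" by (simp add: finite_vars)
  then obtain l where l: "\<And>a i. a \<in> set As \<Longrightarrow> i \<in> vars a \<Longrightarrow> i < l"
    unfolding finite_nat_set_iff_bounded by blast
  \<comment> \<open>\<open>Suc l\<close> instead of \<open>l\<close> guarantees an exponent with
    index 0, which is compared with \<open>e\<close>.\<close>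
  then have "\<And>a. a \<in> set As \<Longrightarrow> vars a \<subseteq> {..<Suc l}"
    using less_SucI by blast
  then obtain k \<mu> where k: "0 < k" "family k \<mu>"
    and inj: "\<And>e. inj_on (morph_word k (\<mu> e)) (K (Suc (Suc l))) \<longleftrightarrow> \<not> diagonal e"
    using injective_iff_unsolvable[of As "Suc l"] unfolding diagonal by blast
  have "\<not> decidable_on (uptr_morphisms k) (encode_morph k) (\<lambda>\<mu>. inj_on (morph_word k \<mu>) (K (Suc (Suc l))))"
  proof
    assume "decidable_on (uptr_morphisms k) (encode_morph k) (\<lambda>\<mu>. inj_on (morph_word k \<mu>) (K (Suc (Suc l))))"
    then obtain f where "\<forall>\<nu>\<in>uptr_morphisms k. rec_eval f [encode_morph k \<nu>]
        (if inj_on (morph_word k \<nu>) (K (Suc (Suc l))) then 1 else 0)"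
      unfolding decidable_on_def by blast
    moreover have "\<mu> e \<in> uptr_morphisms k" for e
      using k(2) unfolding family_def by blast
    ultimately have f: "rec_eval f [encode_morph k (\<mu> e)] (if \<not> diagonal e then 1 else 0)" for e
      unfolding inj[symmetric] by blast
    obtain h where "\<And>e. rec_eval h [e] (encode_morph k (\<mu> e))"
      using computable_encode_morph[OF k(2)] unfolding computable_def by blast
    then have g: "rec_eval (Cn f [h]) [e] (if \<not> diagonal e then 1 else 0)" for e
      using f by (rule rec_eval_comp1)
    \<comment> \<open>Let \<open>c\<close> be the code of \<open>Cn f [h]\<close>. If
      \<open>diagonal c\<close> holds, this function takes both values 0 and 1 at \<open>c\<close>;
      otherwise its value 1 at \<open>c\<close> means \<open>diagonal c\<close>.\<close>
    show False
      using g[of "code (Cn f [h])"] diagonal_code[of "Cn f [h]"]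
        rec_eval_unique[of "Cn f [h]" "[code (Cn f [h])]" 0 1]
      by (auto split: if_splits)
  qed
  then show ?thesis using k(1) by blast
qed

end
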